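(* (i) Let $(\sigma_n)_{n\in\mathbb N}$ be a convergent permutation sequence with $|\sigma_n|\to\infty$. Then there exists a limit permutation $Z\in\mathcal Z$ such that $\sigma_n\to Z$. (ii) Conversely, for every $Z\in\mathcal Z$ there exists a permutation sequence $(\sigma_n)_{n\in\mathbb N}$ with $|\sigma_n|\to\infty$ such that $\sigma_n\to Z$.
   Context: For a positive integer $n$, $S_n$ denotes the set of permutations of $[n]=\{1,\dots,n\}$; for $\sigma\in S_n$ write $|\sigma|=n$, and let $\mathcal S=\bigcup_{n\ge1}S_n$. For $\tau\in S_k$ and $\pi\in S_n$, let $\Lambda(\tau,\pi)$ be the number of $k$-tuples $(x_1,\dots,x_k)$ with $1\le x_1<\dots<x_k\le n$ such that for all $i,j\in[k]$, $\pi(x_i)<\pi(x_j)$ iff $\tau(i)<\tau(j)$. The density of $\tau$ in $\pi$ is $t(\tau,\pi)=\binom{n}{k}^{-1}\Lambda(\tau,\pi)$ if $k\le n$ and $t(\tau,\pi)=0$ if $k>n$. A permutation sequence $(\sigma_n)_{n\in\mathbb N}$ is convergent if for every $\tau\in\mathcal S$ the real sequence $(t(\tau,\sigma_n))_n$ converges. A function $F:[0,1]\to[0,1]$ is a cdf if it is non-decreasing, right-continuous and $F(1)=1$. A limit permutation is a Lebesgue measurable function $Z:[0,1]^2\to[0,1]$ such that (a) for every $x\in[0,1]$, $Z(x,\cdot)$ is a cdf, and (b) for every $y\in[0,1]$, $\int_0^1 Z(x,y)\,dx=y$. $\mathcal Z$ denotes the set of limit permutations. The random pair $(X,Y)$ associated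 with $Z$ is obtained by choosing $X$ uniform on $[0,1]$ and then, given $X$, choosing $Y$ with cdf $Z(X,\cdot)$; equivalently $\mathbb P(X\le x,Y\le y)=\int_0^x Z(u,y)\,du$. For $k\in\mathbb N$, the $Z$-random permutation $\sigma(k,Z)\in S_k$ is defined by taking $k$ i.i.d. copies $(X_1,Y_1),\dots,(X_k,Y_k)$ of the pair associated with $Z$ (almost surely all $X_i$ are distinct and all $Y_i$ are distinct) and setting $\sigma(i)=j$ iff the point with the $i$-th smallest first coordinate has the $j$-th smallest second coordinate. For $\tau\in S_k$, $t(\tau,Z)=\mathbb P(\sigma(k,Z)=\tau)$. For a permutation sequence with $|\sigma_n|\to\infty$ and $Z\in\mathcal Z$, we write $\sigma_n\to Z$ if $\lim_{n\to\infty}t(\tau,\sigma_n)=t(\tau,Z)$ for every $\tau\in\mathcal S$. *)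

theory Defs
  imports "HOL-Probability.Probability" "HOL-Combinatorics.Permutations"
begin

text \<open>
  A permutation of \<open>{1..n}\<close> does not determine \<open>n\<close> when represented as a function that is the
  identity elsewhere, so an element of \<open>S\<^sub>n\<close> is a pair of its size \<open>n\<close> and such a function.
\<close>

type_synonym sized_perm = "nat \<times> (nat \<Rightarrow> nat)"

definition perms :: "sized_perm set" where
  "perms = (SIGMA n:{1..}. {p. p permutes {1..n}})"

abbreviation perm_size :: "sized_perm \<Rightarrow> nat" where
  "perm_size \<equiv> fst"

abbreviation perm_fun :: "sized_perm \<Rightarrow> nat \<Rightarrow> nat" where
  "perm_fun \<equiv> snd"

definition occurrences :: "sized_perm \<Rightarrow> sized_perm \<Rightarrow> nat" where
  "occurrences \<tau> \<pi> =
     card {x \<in> {1..perm_size \<tau>} \<rightarrow>\<^sub>E {1..perm_size \<pi>}.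
             strict_mono_on {1..perm_size \<tau>} x \<and>
             (\<forall>i\<in>{1..perm_size \<tau>}. \<forall>j\<in>{1..perm_size \<tau>}.
                perm_fun \<pi> (x i) < perm_fun \<pi> (x j) \<longleftrightarrow> perm_fun \<tau> i < perm_fun \<tau> j)}"

definition pattern_density :: "sized_perm \<Rightarrow> sized_perm \<Rightarrow> real" where
  "pattern_density \<tau> \<pi> =
     (if perm_size \<tau> \<le> perm_size \<pi>
      then real (occurrences \<tau> \<pi>) / real (perm_size \<pi> choose perm_size \<tau>)
      else 0)"

definition perm_sequence :: "(nat \<Rightarrow> sized_perm) \<Rightarrow> bool" where
  "perm_sequence \<sigma> \<longleftrightarrow> (\<forall>n. \<sigma> n \<in> perms)"

definition convergent_perm_sequence :: "(nat \<Rightarrow> sized_perm) \<Rightarrow> bool" where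
  "convergent_perm_sequence \<sigma> \<longleftrightarrow>
     perm_sequence \<sigma> \<and> (\<forall>\<tau>\<in>perms. convergent (\<lambda>n. pattern_density \<tau> (\<sigma> n)))"

definition unit_cdf :: "(real \<Rightarrow> real) \<Rightarrow> bool" where
  "unit_cdf F \<longleftrightarrow>
     F \<in> {0..1} \<rightarrow> {0..1} \<and> mono_on {0..1} F \<and>
     (\<forall>y\<in>{0..<1}. continuous (at_right y) F) \<and> F 1 = 1"

text \<open>
  Only the values of \<open>Z\<close> on the unit square matter. Each section \<open>\<lambda>x. Z x y\<close> is Lebesgue measurable
  on the unit interval (almost every section is by Fubini, hence all of them by right-continuity),
  so the integral below is never a default value.
\<close>

definition limit_perm :: "(real \<Rightarrow> real \<Rightarrow> real) \<Rightarrow> bool" where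
  "limit_perm Z \<longleftrightarrow>
     (\<lambda>(x, y). Z x y) \<in> borel_measurable (lebesgue_on ({0..1} \<times> {0..1})) \<and>
     (\<forall>x\<in>{0..1}. unit_cdf (Z x)) \<and>
     (\<forall>y\<in>{0..1}. (LINT x|lebesgue_on {0..1}. Z x y) = y)"

text \<open>
  The probability measure on the line with cdf \<open>F\<close> on the unit interval; extending \<open>F\<close> by \<open>0\<close> to
  the left puts mass \<open>F 0\<close> at the point \<open>0\<close>.
\<close>

definition cdf_measure :: "(real \<Rightarrow> real) \<Rightarrow> real measure" where
  "cdf_measure F = interval_measure (\<lambda>y. if y < 0 then 0 else if y \<le> 1 then F y else 1)"

text \<open>
  The law of \<open>(X, Y)\<close>: \<open>X\<close> is uniform on the unit interval and \<open>Y\<close> has cdf \<open>Z X\<close> given \<open>X\<close>.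
  The source is \<open>lebesgue_on\<close> rather than \<open>lborel\<close> because the kernel is only Lebesgue measurable.
\<close>

definition pair_law :: "(real \<Rightarrow> real \<Rightarrow> real) \<Rightarrow> (real \<times> real) measure" where
  "pair_law Z = lebesgue_on {0..1} \<bind> (\<lambda>x. distr (cdf_measure (Z x)) borel (\<lambda>y. (x, y)))"

definition samples :: "nat \<Rightarrow> (real \<Rightarrow> real \<Rightarrow> real) \<Rightarrow> (nat \<Rightarrow> real \<times> real) measure" where
  "samples k Z = (\<Pi>\<^sub>M i\<in>{1..k}. pair_law Z)"

definition rank_among :: "nat \<Rightarrow> (nat \<Rightarrow> real) \<Rightarrow> nat \<Rightarrow> nat" where
  "rank_among k a m = card {l\<in>{1..k}. a l \<le> a m}"

text \<open>
  The \<open>i\<close>-th smallest of distinct values \<open>a 1, \<dots>, a k\<close> is the one of rank \<open>i\<close>. The value of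
  \<open>perm_of_points\<close> when coordinates coincide is irrelevant, as this happens with probability zero.
\<close>

definition perm_of_points :: "nat \<Rightarrow> (nat \<Rightarrow> real \<times> real) \<Rightarrow> nat \<Rightarrow> nat" where
  "perm_of_points k \<omega> i =
     (if i \<in> {1..k}
      then THE j. \<exists>m\<in>{1..k}. rank_among k (fst \<circ> \<omega>) m = i \<and> rank_among k (snd \<circ> \<omega>) m = j
      else i)"

definition limit_density :: "sized_perm \<Rightarrow> (real \<Rightarrow> real \<Rightarrow> real) \<Rightarrow> real" where
  "limit_density \<tau> Z =
     measure (samples (perm_size \<tau>) Z)
       {\<omega> \<in> space (samples (perm_size \<tau>) Z). perm_of_points (perm_size \<tau>) \<omega> = perm_fun \<tau>}"

definition perms_converge_to :: "(nat \<Rightarrow> sized_perm) \<Rightarrow> (real \<Rightarrow> real \<Rightarrow> real) \<Rightarrow> bool" where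
  "perms_converge_to \<sigma> Z \<longleftrightarrow>
     (\<forall>\<tau>\<in>perms. (\<lambda>n. pattern_density \<tau> (\<sigma> n)) \<longlonglongrightarrow> limit_density \<tau> Z)"

end

theory Submission
  imports Defs "HOL-Complex_Analysis.Great_Picard"
begin

text \<open>
  The density of a pattern of size \<open>k\<close> in a permutation of size \<open>N\<close> is, up to a factor tending to
  \<open>k!\<close>, the probability that \<open>k\<close> independent uniform points of its graph, scaled to the unit square,
  realize the pattern in the order in which they are drawn; the same holds exactly for a limit
  permutation and its associated pair. On a fine grid this probability is nearly a polynomial in the
  cell probabilities, so convergence of the planar distribution functions at rational points implies
  convergence of all pattern densities.

  For (i), the empirical distribution functions of a subsequence converge everywhere to a copula \<open>F\<close>.
  Each \<open>F \<cdot> q\<close> is 1-Lipschitz and hence has a Radon-Nikodym density \<open>f\<^sub>q\<close>; for rational \<open>q\<close> these are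
  almost everywhere increasing in \<open>q\<close>, and \<open>Z x y = inf {f\<^sub>q x | q > y}\<close>. For (ii), Hoeffding's
  inequality yields samples of the pair associated with \<open>Z\<close> whose empirical distribution functions
  converge at all rational points.
\<close>

text \<open>The pattern of a sample involves sorting it, which is awkward to approximate. Fixing the
  order of the draws removes the sorting and costs the same factor on both sides: k! by symmetry for
  the limit, and the limit of N^k / binom(N, k) for a permutation, whose points are drawn with
  replacement. The obstacle to reading a pattern off the grid is two points in one row or column.
  For uniform marginals this has probability O(k^2 / m) on an m by m grid. For the approximating
  samples the corresponding defect is not estimated at all: it is 1 minus a polynomial in the cell
  probabilities, so it converges to the defect of the limit. Hence only distribution functions at
  grid corners are ever compared, and one limit theorem serves both directions. Rational points do
  double work in (i): there are countably many, so a diagonal subsequence exists and the exceptional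
  null sets of the densities can be merged into one. Uniformly small increments then give
  convergence at all points.\<close>

section \<open>Ranks and the permutation of a finite set of points\<close>

lemma bij_betw_card_le:
  fixes f :: "nat \<Rightarrow> nat"
  assumes "bij_betw f {1..k} {1..k}" "i \<in> {1..k}"
  shows "card {j \<in> {1..k}. f j \<le> f i} = f i"
proof -
  have "f ` {j \<in> {1..k}. f j \<le> f i} = {1..f i}"
  proof
    show "f ` {j \<in> {1..k}. f j \<le> f i} \<subseteq> {1..f i}"
      using assms(1) by (force simp: bij_betw_def)
    show "{1..f i} \<subseteq> f ` {j \<in> {1..k}. f j \<le> f i}"
    proof
      fix v assume v: "v \<in> {1..f i}"
      have "f i \<in> {1..k}" using assms by (auto simp: bij_betw_def)
      with v have "v \<in> f ` {1..k}" using assms(1) by (auto simp: bij_betw_def)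
      with v show "v \<in> f ` {j \<in> {1..k}. f j \<le> f i}" by auto
    qed
  qed
  moreover have "inj_on f {j \<in> {1..k}. f j \<le> f i}"
    using assms(1) by (auto simp: bij_betw_def intro: inj_on_subset)
  ultimately show ?thesis by (metis card_image card_atLeastAtMost diff_Suc_1)
qed

text \<open>The value at i counts the arguments whose value is no larger, so it is determined by the
  induced order alone.\<close>

lemma bij_betw_eq_if_order_eq:
  fixes f g :: "nat \<Rightarrow> nat"
  assumes "bij_betw f {1..k} {1..k}" "bij_betw g {1..k} {1..k}"
    and "\<And>i j. i \<in> {1..k} \<Longrightarrow> j \<in> {1..k} \<Longrightarrow> f i < f j \<longleftrightarrow> g i < g j"
    and "i \<in> {1..k}"
  shows "f i = g i"
proof -
  have "{j \<in> {1..k}. f j \<le> f i} = {j \<in> {1..k}. g j \<le> g i}"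
    using assms(3,4) by (auto simp: not_less[symmetric])
  then show ?thesis
    using bij_betw_card_le assms by metis
qed

lemma rank_among_less_iff:
  assumes "inj_on a {1..k}" "m \<in> {1..k}" "m' \<in> {1..k}"
  shows "rank_among k a m < rank_among k a m' \<longleftrightarrow> a m < a m'"
proof -
  have less: "rank_among k a m < rank_among k a m'" if "a m < a m'" "m \<in> {1..k}" "m' \<in> {1..k}" for m m'
    unfolding rank_among_def
  proof (rule psubset_card_mono)
    have "m' \<in> {l \<in> {1..k}. a l \<le> a m'}" "m' \<notin> {l \<in> {1..k}. a l \<le> a m}" using that by auto
    moreover have "{l \<in> {1..k}. a l \<le> a m} \<subseteq> {l \<in> {1..k}. a l \<le> a m'}" using that by auto
    ultimately show "{l \<in> {1..k}. a l \<le> a m} \<subset> {l \<in> {1..k}. a l \<le> a m'}" by blast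
  qed auto
  consider "a m < a m'" | "m = m'" | "a m' < a m"
    using assms by (meson inj_onD linorder_neqE_linordered_idom)
  then show ?thesis
    using less[of m m'] less[of m' m] assms by cases auto
qed

lemma bij_betw_rank_among:
  assumes "inj_on a {1..k}"
  shows "bij_betw (rank_among k a) {1..k} {1..k}"
proof -
  have "inj_on (rank_among k a) {1..k}"
    by (rule inj_onI) (metis assms inj_onD linorder_neqE_linordered_idom nat_neq_iff rank_among_less_iff)
  moreover have "rank_among k a ` {1..k} \<subseteq> {1..k}"
  proof
    fix v assume "v \<in> rank_among k a ` {1..k}"
    then obtain m where m: "m \<in> {1..k}" "v = rank_among k a m" by auto
    have "card {m} \<le> v" "v \<le> card {1..k}"
      unfolding m(2) rank_among_def by (rule card_mono; use m(1) in auto)+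
    then show "v \<in> {1..k}" by auto
  qed
  ultimately show ?thesis
    by (simp add: bij_betw_def endo_inj_surj)
qed

lemma perm_of_points_rank_among:
  assumes "inj_on (fst \<circ> \<omega>) {1..k}" "inj_on (snd \<circ> \<omega>) {1..k}" "m \<in> {1..k}"
  shows "perm_of_points k \<omega> (rank_among k (fst \<circ> \<omega>) m) = rank_among k (snd \<circ> \<omega>) m"
proof -
  let ?r = "rank_among k (fst \<circ> \<omega>)"
  have b: "bij_betw ?r {1..k} {1..k}" using assms(1) by (rule bij_betw_rank_among)
  then have "?r m \<in> {1..k}" using assms(3) by (auto simp: bij_betw_def)
  moreover have "(THE j. \<exists>m'\<in>{1..k}. ?r m' = ?r m \<and> rank_among k (snd \<circ> \<omega>) m' = j) =
      rank_among k (snd \<circ> \<omega>) m"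
    using assms(3) inj_onD[OF bij_betw_imp_inj_on[OF b]] by (intro the_equality) blast+
  ultimately show ?thesis by (simp add: perm_of_points_def)
qed

lemma perm_of_points_permutes:
  assumes "inj_on (fst \<circ> \<omega>) {1..k}" "inj_on (snd \<circ> \<omega>) {1..k}"
  shows "perm_of_points k \<omega> permutes {1..k}"
proof (rule bij_imp_permutes)
  let ?r = "rank_among k (fst \<circ> \<omega>)"
  have bx: "bij_betw ?r {1..k} {1..k}" using assms(1) by (rule bij_betw_rank_among)
  have "bij_betw (perm_of_points k \<omega> \<circ> ?r) {1..k} {1..k}"
    using bij_betw_rank_among[OF assms(2)] perm_of_points_rank_among[OF assms]
    by (subst bij_betw_cong[where g = "rank_among k (snd \<circ> \<omega>)"]) auto
  then show "bij_betw (perm_of_points k \<omega>) {1..k} {1..k}"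
    using bij_betw_comp_iff[OF bx] by blast
  show "perm_of_points k \<omega> x = x" if "x \<notin> {1..k}" for x
    using that by (auto simp: perm_of_points_def)
qed

text \<open>The pattern has to appear in the order of the indices. No sorting is involved, so this
  is a finite conjunction of coordinate comparisons. For x the one implication fixes the order of
  all pairs; for y the equivalence also excludes ties wherever \<open>t\<close> is
  injective.\<close>

definition realizes :: "nat \<Rightarrow> (nat \<Rightarrow> nat) \<Rightarrow> (nat \<Rightarrow> real) \<Rightarrow> (nat \<Rightarrow> real) \<Rightarrow> bool" where
  "realizes k t x y \<longleftrightarrow> (\<forall>i\<in>{1..k}. \<forall>j\<in>{1..k}. (i < j \<longrightarrow> x i < x j) \<and> (y i < y j \<longleftrightarrow> t i < t j))"

text \<open>The points carry arbitrary labels, whereas an occurrence is an increasing tuple of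
  positions. Composing a tuple of labels with the ranking by first coordinate translates one into
  the other, and it is bijective because the ranking is.\<close>

lemma occurrences_perm_of_points:
  assumes "inj_on (fst \<circ> \<omega>) {1..N}" "inj_on (snd \<circ> \<omega>) {1..N}"
  shows "occurrences (k, t) (N, perm_of_points N \<omega>) =
    card {f \<in> {1..k} \<rightarrow>\<^sub>E {1..N}. realizes k t (\<lambda>i. fst (\<omega> (f i))) (\<lambda>i. snd (\<omega> (f i)))}"
    (is "_ = card ?B")
proof -
  let ?r = "rank_among N (fst \<circ> \<omega>)" and ?p = "perm_of_points N \<omega>"
  let ?A = "{x \<in> {1..k} \<rightarrow>\<^sub>E {1..N}. strict_mono_on {1..k} x \<and>
             (\<forall>i\<in>{1..k}. \<forall>j\<in>{1..k}. ?p (x i) < ?p (x j) \<longleftrightarrow> t i < t j)}"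
  have b: "bij_betw ?r {1..N} {1..N}" using assms(1) by (rule bij_betw_rank_among)
  have iff: "(\<lambda>i\<in>{1..k}. ?r (f i)) \<in> ?A \<longleftrightarrow> f \<in> ?B" if f: "f \<in> {1..k} \<rightarrow>\<^sub>E {1..N}" for f
  proof -
    have fN: "f i \<in> {1..N}" if "i \<in> {1..k}" for i using f that by auto
    then have rN: "?r (f i) \<in> {1..N}" if "i \<in> {1..k}" for i
      using b that unfolding bij_betw_def by blast
    have "?p (?r (f i)) < ?p (?r (f j)) \<longleftrightarrow> snd (\<omega> (f i)) < snd (\<omega> (f j))"
      if "i \<in> {1..k}" "j \<in> {1..k}" for i j
      using that fN rank_among_less_iff[OF assms(2)] by (simp add: perm_of_points_rank_among[OF assms])
    moreover have "?r (f i) < ?r (f j) \<longleftrightarrow> fst (\<omega> (f i)) < fst (\<omega> (f j))"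
      if "i \<in> {1..k}" "j \<in> {1..k}" for i j
      using that fN rank_among_less_iff[OF assms(1)] by simp
    moreover have "(\<lambda>i\<in>{1..k}. ?r (f i)) \<in> {1..k} \<rightarrow>\<^sub>E {1..N}" using rN by auto
    ultimately show ?thesis
      using f by (simp add: realizes_def monotone_on_def ball_conj_distrib)
  qed
  have "bij_betw (\<lambda>f. \<lambda>i\<in>{1..k}. ?r (f i)) ?B ?A"
  proof (rule bij_betw_imageI)
    show "inj_on (\<lambda>f. \<lambda>i\<in>{1..k}. ?r (f i)) ?B"
    proof (rule inj_onI)
      fix f g assume fg: "f \<in> ?B" "g \<in> ?B" "(\<lambda>i\<in>{1..k}. ?r (f i)) = (\<lambda>i\<in>{1..k}. ?r (g i))"
      show "f = g"
      proof (rule PiE_ext)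
        show "f \<in> {1..k} \<rightarrow>\<^sub>E {1..N}" "g \<in> {1..k} \<rightarrow>\<^sub>E {1..N}" using fg by auto
        fix i assume i: "i \<in> {1..k}"
        have "?r (f i) = ?r (g i)" using fun_cong[OF fg(3), of i] i by simp
        moreover have "f i \<in> {1..N}" "g i \<in> {1..N}" using fg i by auto
        ultimately show "f i = g i" using b unfolding bij_betw_def by (blast dest: inj_onD)
      qed
    qed
    have "x \<in> (\<lambda>f. \<lambda>i\<in>{1..k}. ?r (f i)) ` ?B" if x: "x \<in> ?A" for x
    proof -
      let ?f = "\<lambda>i\<in>{1..k}. inv_into {1..N} ?r (x i)"
      have xN: "x i \<in> {1..N}" if "i \<in> {1..k}" for i using x that by auto
      then have fN: "inv_into {1..N} ?r (x i) \<in> {1..N}" if "i \<in> {1..k}" for i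
        using that b inv_into_into[of "x i" ?r "{1..N}"] unfolding bij_betw_def by metis
      then have f: "?f \<in> {1..k} \<rightarrow>\<^sub>E {1..N}" by auto
      have eq: "(\<lambda>i\<in>{1..k}. ?r (?f i)) = x"
      proof (rule PiE_ext)
        show "x \<in> {1..k} \<rightarrow>\<^sub>E {1..N}" using x by auto
        show "(\<lambda>i\<in>{1..k}. ?r (?f i)) \<in> {1..k} \<rightarrow>\<^sub>E {1..N}"
          using fN b unfolding bij_betw_def by auto
        fix i assume i: "i \<in> {1..k}"
        then show "(\<lambda>i\<in>{1..k}. ?r (?f i)) i = x i"
          using xN[OF i] b by (simp add: bij_betw_inv_into_right)
      qed
      have "(\<lambda>i\<in>{1..k}. ?r (?f i)) \<in> ?A" by (subst eq) (rule x)
      then have "?f \<in> ?B" by (rule iff[OF f, THEN iffD1])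
      then show ?thesis by (rule rev_image_eqI) (rule eq[symmetric])
    qed
    then have "?A \<subseteq> (\<lambda>f. \<lambda>i\<in>{1..k}. ?r (f i)) ` ?B" by (rule subsetI)
    moreover have "(\<lambda>f. \<lambda>i\<in>{1..k}. ?r (f i)) ` ?B \<subseteq> ?A"
      by (rule image_subsetI, rule iff[THEN iffD2]) auto
    ultimately show "(\<lambda>f. \<lambda>i\<in>{1..k}. ?r (f i)) ` ?B = ?A" by (rule equalityI[rotated])
  qed
  then have "card ?B = card ?A" by (rule bij_betw_same_card)
  then show ?thesis by (simp add: occurrences_def)
qed

lemma occurrences_eq_card_realizes:
  assumes "n \<ge> 1"
  shows "occurrences (k, t) (n, p) =
    card {f \<in> {1..k} \<rightarrow>\<^sub>E {1..n}. realizes k t (\<lambda>i. real (f i) / real n) (\<lambda>i. real (p (f i)) / real n)}"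
proof -
  have "strict_mono_on {1..k} f \<and> (\<forall>i\<in>{1..k}. \<forall>j\<in>{1..k}. p (f i) < p (f j) \<longleftrightarrow> t i < t j) \<longleftrightarrow>
     realizes k t (\<lambda>i. real (f i) / real n) (\<lambda>i. real (p (f i)) / real n)" for f
    using assms by (auto simp: realizes_def monotone_on_def divide_less_cancel)
  then show ?thesis by (simp add: occurrences_def)
qed

text \<open>Ranking after \<open>\<rho>\<close> is an order-preserving bijection of
  \<open>{1..k}\<close>, and the identity is the only one.\<close>

lemma rank_among_comp_increasing:
  assumes "inj_on x {1..k}" "\<rho> permutes {1..k}" "\<And>i j. i \<in> {1..k} \<Longrightarrow> j \<in> {1..k} \<Longrightarrow> i < j \<Longrightarrow> x (\<rho> i) < x (\<rho> j)"
    and "i \<in> {1..k}"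
  shows "rank_among k x (\<rho> i) = i"
proof -
  have b: "bij_betw (rank_among k x \<circ> \<rho>) {1..k} {1..k}"
    using bij_betw_rank_among[OF assms(1)] permutes_imp_bij[OF assms(2)] by (rule bij_betw_trans[rotated])
  have "(rank_among k x \<circ> \<rho>) i = id i"
  proof (rule bij_betw_eq_if_order_eq[OF b _ _ assms(4)])
    fix i j assume ij: "i \<in> {1..k}" "j \<in> {1..k}"
    then have "\<rho> i \<in> {1..k}" "\<rho> j \<in> {1..k}" using assms(2) by (simp_all only: permutes_in_image)
    then show "(rank_among k x \<circ> \<rho>) i < (rank_among k x \<circ> \<rho>) j \<longleftrightarrow> id i < id j"
      using rank_among_less_iff[OF assms(1)] assms(3) ij
      by (metis comp_apply id_apply less_asym linorder_neqE_nat)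
  qed (rule bij_betw_id)
  then show ?thesis by simp
qed

text \<open>Either rearrangement inverts the ranking by x. Hence the events belonging to different
  rearrangements are disjoint, which produces the factor k! in
  \<open>limit_density_eq\<close>.\<close>

lemma realizes_comp_unique:
  assumes "inj_on x {1..k}" "\<rho> permutes {1..k}" "\<rho>' permutes {1..k}"
    and "realizes k t (x \<circ> \<rho>) y" "realizes k t (x \<circ> \<rho>') y'"
  shows "\<rho> = \<rho>'"
proof
  fix i
  show "\<rho> i = \<rho>' i"
  proof (cases "i \<in> {1..k}")
    case True
    have "rank_among k x (\<rho> i) = i" "rank_among k x (\<rho>' i) = i"
      using assms True by (auto intro!: rank_among_comp_increasing simp: realizes_def)
    moreover have "\<rho> i \<in> {1..k}" "\<rho>' i \<in> {1..k}"
      using assms(2,3) True by (simp_all only: permutes_in_image)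
    ultimately show ?thesis
      using bij_betw_rank_among[OF assms(1)] unfolding bij_betw_def by (metis inj_onD)
  qed (use assms(2,3) in \<open>simp add: permutes_not_in\<close>)
qed

text \<open>The rearrangement that lists the points from left to right is the inverse of the ranking
  by first coordinate. After it, the ranks by second coordinate are the values of the
  permutation.\<close>

lemma perm_of_points_eq_iff:
  assumes x: "inj_on (fst \<circ> \<omega>) {1..k}" and y: "inj_on (snd \<circ> \<omega>) {1..k}" and t: "t permutes {1..k}"
  shows "perm_of_points k \<omega> = t \<longleftrightarrow>
    (\<exists>\<rho>. \<rho> permutes {1..k} \<and> realizes k t (fst \<circ> \<omega> \<circ> \<rho>) (snd \<circ> \<omega> \<circ> \<rho>))"
proof
  let ?rx = "rank_among k (fst \<circ> \<omega>)" and ?ry = "rank_among k (snd \<circ> \<omega>)"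
  have bx: "bij_betw ?rx {1..k} {1..k}" and bY: "bij_betw ?ry {1..k} {1..k}"
    using bij_betw_rank_among[OF x] bij_betw_rank_among[OF y] by simp_all
  {
    assume eq: "perm_of_points k \<omega> = t"
    define \<rho> where "\<rho> = (\<lambda>i. if i \<in> {1..k} then inv_into {1..k} ?rx i else i)"
    have "bij_betw \<rho> {1..k} {1..k}"
      using bij_betw_inv_into[OF bx] by (subst bij_betw_cong[where g = "inv_into {1..k} ?rx"]) (auto simp: \<rho>_def)
    then have \<rho>: "\<rho> permutes {1..k}" by (rule bij_imp_permutes) (auto simp: \<rho>_def)
    have in_k: "\<rho> i \<in> {1..k}" if "i \<in> {1..k}" for i
      using that \<rho> by (simp only: permutes_in_image)
    have rx: "?rx (\<rho> i) = i" if "i \<in> {1..k}" for i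
      using that bx by (simp add: \<rho>_def bij_betw_inv_into_right)
    have ry: "?ry (\<rho> i) = t i" if "i \<in> {1..k}" for i
      using perm_of_points_rank_among[OF x y in_k[OF that]] rx[OF that] eq by simp
    have "realizes k t (fst \<circ> \<omega> \<circ> \<rho>) (snd \<circ> \<omega> \<circ> \<rho>)"
      unfolding realizes_def
      using rank_among_less_iff[OF x in_k in_k] rank_among_less_iff[OF y in_k in_k] rx ry by simp
    with \<rho> show "\<exists>\<rho>. \<rho> permutes {1..k} \<and> realizes k t (fst \<circ> \<omega> \<circ> \<rho>) (snd \<circ> \<omega> \<circ> \<rho>)" by blast
  next
    assume "\<exists>\<rho>. \<rho> permutes {1..k} \<and> realizes k t (fst \<circ> \<omega> \<circ> \<rho>) (snd \<circ> \<omega> \<circ> \<rho>)"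
    then obtain \<rho> where \<rho>: "\<rho> permutes {1..k}" and R: "realizes k t (fst \<circ> \<omega> \<circ> \<rho>) (snd \<circ> \<omega> \<circ> \<rho>)" by blast
    have in_k: "\<rho> i \<in> {1..k}" if "i \<in> {1..k}" for i
      using that \<rho> by (simp only: permutes_in_image)
    have rx: "?rx (\<rho> i) = i" if "i \<in> {1..k}" for i
      using that R by (intro rank_among_comp_increasing[OF x \<rho>]) (auto simp: realizes_def)
    have ry: "(?ry \<circ> \<rho>) i = t i" if "i \<in> {1..k}" for i
    proof (rule bij_betw_eq_if_order_eq[OF _ _ _ that])
      show "bij_betw (?ry \<circ> \<rho>) {1..k} {1..k}"
        using bY permutes_imp_bij[OF \<rho>] by (rule bij_betw_trans[rotated])
      show "bij_betw t {1..k} {1..k}" using t by (rule permutes_imp_bij)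
      show "(?ry \<circ> \<rho>) i < (?ry \<circ> \<rho>) j \<longleftrightarrow> t i < t j" if "i \<in> {1..k}" "j \<in> {1..k}" for i j
        using rank_among_less_iff[OF y in_k in_k] R that by (simp add: realizes_def)
    qed
    show "perm_of_points k \<omega> = t"
    proof
      fix i
      show "perm_of_points k \<omega> i = t i"
        using perm_of_points_rank_among[OF x y in_k, of i] rx[of i] ry[of i] t
        by (cases "i \<in> {1..k}") (auto simp: perm_of_points_def permutes_def)
    qed
  }
qed

declare One_nat_def [simp del]

section \<open>Grid cells and placements\<close>

text \<open>Cells are open on the left and closed on the right, so each is a difference of two
  events of the form x \<le> c, the kind that a distribution function measures. They tile (0, 1];
  the point 0 lies in none of them.\<close>

definition in_grid :: "nat \<Rightarrow> nat \<Rightarrow> real \<Rightarrow> bool" where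
  "in_grid m a x \<longleftrightarrow> real a / real m < x \<and> x \<le> (real a + 1) / real m"

lemma in_grid_less_iff:
  assumes "in_grid m a x" "in_grid m b y" "a \<noteq> b"
  shows "x < y \<longleftrightarrow> a < b"
proof -
  have less: "x < y" if "in_grid m a x" "in_grid m b y" "a < b" for a b x y
  proof -
    have "x \<le> (real a + 1) / real m" "real b / real m < y" using that by (auto simp: in_grid_def)
    moreover have "(real a + 1) / real m \<le> real b / real m" using that by (intro divide_right_mono) auto
    ultimately show ?thesis by linarith
  qed
  show ?thesis using less[of a x b y] less[of b y a x] assms by (metis less_asym linorder_neqE_nat)
qed

lemma in_grid_unique: "in_grid m a x \<Longrightarrow> in_grid m b x \<Longrightarrow> a = b"
  using in_grid_less_iff[of m a x b x] in_grid_less_iff[of m b x a x] by (cases a b rule: linorder_cases) auto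

lemma in_grid_exists:
  assumes "0 < m" "0 < x" "x \<le> 1"
  obtains a where "a < m" "in_grid m a x"
proof
  \<comment> \<open>Cells are closed on the right, so the index is the ceiling minus one; it is
    nonnegative because x is positive.\<close>
  let ?c = "\<lceil>real m * x\<rceil>"
  have c: "0 < ?c" "?c \<le> int m" using assms by (auto simp: ceiling_le_iff mult_le_one)
  then show "nat (?c - 1) < m" by linarith
  have "real (nat (?c - 1)) < real m * x" "real m * x \<le> real (nat (?c - 1)) + 1"
    using c by (auto simp: of_nat_nat) linarith+
  then show "in_grid m (nat (?c - 1)) x"
    using assms by (auto simp: in_grid_def field_simps)
qed

text \<open>With distinct columns and distinct rows, the cells decide every comparison of
  coordinates between different points.\<close>

definition grid_placements :: "nat \<Rightarrow> nat \<Rightarrow> (nat \<Rightarrow> nat \<times> nat) set" where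
  "grid_placements k m = {f \<in> {1..k} \<rightarrow>\<^sub>E {..<m} \<times> {..<m}.
     inj_on (\<lambda>i. fst (f i)) {1..k} \<and> inj_on (\<lambda>i. snd (f i)) {1..k}}"

lemma finite_grid_placements: "finite (grid_placements k m)"
proof (rule finite_subset)
  show "grid_placements k m \<subseteq> {1..k} \<rightarrow>\<^sub>E {..<m} \<times> {..<m}" by (auto simp: grid_placements_def)
qed (intro finite_PiE; simp)

section \<open>Samples from a planar distribution and their grid approximation\<close>

text \<open>Coordinates are random variables on an abstract space. This covers both the uniform
  measure on the indices of a permutation, with its scaled graph as coordinates, and the law of the
  pair associated with a limit permutation, with the two projections.\<close>

locale planar_sample = prob_space M for M :: "'a measure" +
  fixes X Y :: "'a \<Rightarrow> real"
  assumes measurable_X [measurable]: "X \<in> borel_measurable M"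
    and measurable_Y [measurable]: "Y \<in> borel_measurable M"
begin

abbreviation sample :: "nat \<Rightarrow> (nat \<Rightarrow> 'a) measure" where
  "sample k \<equiv> \<Pi>\<^sub>M i\<in>{1..k}. M"

definition realize_prob :: "nat \<Rightarrow> (nat \<Rightarrow> nat) \<Rightarrow> real" where
  "realize_prob k t = measure (sample k)
     {\<omega> \<in> space (sample k). realizes k t (\<lambda>i. X (\<omega> i)) (\<lambda>i. Y (\<omega> i))}"

definition quadrant_prob :: "real \<Rightarrow> real \<Rightarrow> real" where
  "quadrant_prob p q = prob {z \<in> space M. X z \<le> p \<and> Y z \<le> q}"

definition grid_cell :: "nat \<Rightarrow> nat \<times> nat \<Rightarrow> 'a set" where
  "grid_cell m c = {z \<in> space M. in_grid m (fst c) (X z) \<and> in_grid m (snd c) (Y z)}"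

definition placement_prob :: "nat \<Rightarrow> nat \<Rightarrow> (nat \<Rightarrow> nat \<times> nat) \<Rightarrow> real" where
  "placement_prob k m f = (\<Prod>i\<in>{1..k}. prob (grid_cell m (f i)))"

lemma finite_product_prob_space_sample: "finite_product_prob_space (\<lambda>_. M) {1..k::nat}"
  by unfold_locales auto

lemma prob_space_sample: "prob_space (sample k)"
  by (rule prob_space_PiM) (rule prob_space_axioms)

lemma sets_grid_cell [measurable]: "grid_cell m c \<in> sets M"
  unfolding grid_cell_def in_grid_def by measurable

lemma sets_realizes [measurable]:
  "{\<omega> \<in> space (sample k). realizes k t (\<lambda>i. X (\<omega> i)) (\<lambda>i. Y (\<omega> i))} \<in> sets (sample k)"
  unfolding realizes_def by measurable

text \<open>Inclusion and exclusion at the four corners: first the difference in x inside a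
  horizontal half-plane, then the difference in y. This is how convergence of distribution functions
  reaches the cells.\<close>

lemma prob_grid_cell:
  assumes "0 < m"
  shows "prob (grid_cell m (a, b)) =
    quadrant_prob ((real a + 1) / m) ((real b + 1) / m) - quadrant_prob (a / m) ((real b + 1) / m)
    - (quadrant_prob ((real a + 1) / m) (b / m) - quadrant_prob (a / m) (b / m))"
proof -
  let ?strip = "\<lambda>q. {z \<in> space M. in_grid m a (X z) \<and> Y z \<le> q}"
  have strip: "prob (?strip q) = quadrant_prob ((real a + 1) / m) q - quadrant_prob (a / m) q" for q
  proof -
    have le: "real a / m \<le> (real a + 1) / m" by (intro divide_right_mono) auto
    have "?strip q = {z \<in> space M. X z \<le> (real a + 1) / m \<and> Y z \<le> q} - {z \<in> space M. X z \<le> a / m \<and> Y z \<le> q}"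
      by (auto simp: in_grid_def)
    moreover have "prob \<dots> = quadrant_prob ((real a + 1) / m) q - quadrant_prob (a / m) q"
      unfolding quadrant_prob_def by (rule finite_measure_Diff) (use le in auto)
    ultimately show ?thesis by simp
  qed
  have le: "real b / m \<le> (real b + 1) / m" by (intro divide_right_mono) auto
  have "grid_cell m (a, b) = ?strip ((real b + 1) / m) - ?strip (b / m)"
    by (auto simp: grid_cell_def in_grid_def)
  moreover have "prob (?strip ((real b + 1) / m) - ?strip (b / m)) = prob (?strip ((real b + 1) / m)) - prob (?strip (b / m))"
    unfolding in_grid_def by (rule finite_measure_Diff) (use le in auto)
  ultimately show ?thesis by (simp add: strip)
qed

context
  fixes k m :: nat
begin

definition placement_box :: "(nat \<Rightarrow> nat \<times> nat) \<Rightarrow> (nat \<Rightarrow> 'a) set" where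
  "placement_box f = (\<Pi>\<^sub>E i\<in>{1..k}. grid_cell m (f i))"

lemma sets_placement_box [measurable]: "placement_box f \<in> sets (sample k)"
  unfolding placement_box_def by (rule sets_PiM_I_finite) auto

lemma measure_placement_box: "measure (sample k) (placement_box f) = placement_prob k m f"
  unfolding placement_box_def placement_prob_def
  by (rule finite_product_prob_space.prob_times[OF finite_product_prob_space_sample]) simp

lemma placement_boxD:
  "\<omega> \<in> placement_box f \<Longrightarrow> i \<in> {1..k} \<Longrightarrow> in_grid m (fst (f i)) (X (\<omega> i)) \<and> in_grid m (snd (f i)) (Y (\<omega> i))"
  by (auto simp: placement_box_def grid_cell_def PiE_iff)

lemma disjoint_placement_box: "disjoint_family_on placement_box (grid_placements k m)"
  unfolding disjoint_family_on_def
proof (intro ballI impI)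
  fix f g assume fg: "f \<in> grid_placements k m" "g \<in> grid_placements k m" "f \<noteq> g"
  have "f = g" if \<omega>: "\<omega> \<in> placement_box f" "\<omega> \<in> placement_box g" for \<omega>
  proof (rule PiE_ext)
    show "f \<in> {1..k} \<rightarrow>\<^sub>E {..<m} \<times> {..<m}" "g \<in> {1..k} \<rightarrow>\<^sub>E {..<m} \<times> {..<m}"
      using fg by (auto simp: grid_placements_def)
    show "f i = g i" if "i \<in> {1..k}" for i
      using placement_boxD[OF \<omega>(1) that] placement_boxD[OF \<omega>(2) that] in_grid_unique
      by (metis prod_eqI)
  qed
  with fg(3) show "placement_box f \<inter> placement_box g = {}" by blast
qed

lemma measure_Union_placement_box:
  assumes "G \<subseteq> grid_placements k m"
  shows "measure (sample k) (\<Union>f\<in>G. placement_box f) = (\<Sum>f\<in>G. placement_prob k m f)"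
proof -
  interpret P: prob_space "sample k" by (rule prob_space_sample)
  have "disjoint_family_on placement_box G"
    using disjoint_placement_box assms by (rule disjoint_family_on_mono[rotated])
  then show ?thesis
    using finite_subset[OF assms finite_grid_placements]
    by (subst P.finite_measure_finite_Union) (auto simp: measure_placement_box)
qed

lemma realizes_placement_iff:
  assumes f: "f \<in> grid_placements k m" and \<omega>: "\<omega> \<in> placement_box f"
  shows "realizes k t (\<lambda>i. X (\<omega> i)) (\<lambda>i. Y (\<omega> i)) \<longleftrightarrow>
    realizes k t (\<lambda>i. real (fst (f i))) (\<lambda>i. real (snd (f i)))"
proof -
  have "X (\<omega> i) < X (\<omega> j) \<longleftrightarrow> fst (f i) < fst (f j)" "Y (\<omega> i) < Y (\<omega> j) \<longleftrightarrow> snd (f i) < snd (f j)"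
    if ij: "i \<in> {1..k}" "j \<in> {1..k}" for i j
  proof -
    consider "i = j" | "fst (f i) \<noteq> fst (f j)" "snd (f i) \<noteq> snd (f j)"
      using f ij unfolding grid_placements_def inj_on_def by blast
    then show "X (\<omega> i) < X (\<omega> j) \<longleftrightarrow> fst (f i) < fst (f j)" "Y (\<omega> i) < Y (\<omega> j) \<longleftrightarrow> snd (f i) < snd (f j)"
      using placement_boxD[OF \<omega> ij(1)] placement_boxD[OF \<omega> ij(2)]
      by (cases; auto dest: in_grid_less_iff)+
  qed
  then show ?thesis by (auto simp: realizes_def)
qed

text \<open>Boxes of placements that show the pattern lie inside the event, and the rest of the
  event meets no placement box at all. The error is therefore at most the probability of missing
  every placement box, which is again an expression in the cell probabilities.\<close>

lemma realize_prob_approx: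
  "\<bar>realize_prob k t - (\<Sum>f\<in>{f \<in> grid_placements k m. realizes k t (\<lambda>i. real (fst (f i))) (\<lambda>i. real (snd (f i)))}.
      placement_prob k m f)\<bar> \<le> 1 - (\<Sum>f\<in>grid_placements k m. placement_prob k m f)"
proof -
  interpret P: prob_space "sample k" by (rule prob_space_sample)
  let ?G = "{f \<in> grid_placements k m. realizes k t (\<lambda>i. real (fst (f i))) (\<lambda>i. real (snd (f i)))}"
  let ?D = "{\<omega> \<in> space (sample k). realizes k t (\<lambda>i. X (\<omega> i)) (\<lambda>i. Y (\<omega> i))}"
  let ?S = "\<Union>f\<in>?G. placement_box f" and ?W = "\<Union>f\<in>grid_placements k m. placement_box f"
  have sets: "?S \<in> P.events" "?W \<in> P.events"
    using finite_grid_placements by (auto intro!: sets.finite_UN)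
  have "?S \<subseteq> ?D"
    using realizes_placement_iff sets.sets_into_space[OF sets_placement_box] by blast
  then have 1: "P.prob ?S \<le> P.prob ?D"
    by (rule P.finite_measure_mono) (rule sets_realizes)
  have "?D \<subseteq> ?S \<union> (space (sample k) - ?W)"
    using realizes_placement_iff by blast
  then have "P.prob ?D \<le> P.prob (?S \<union> (space (sample k) - ?W))"
    by (rule P.finite_measure_mono) (use sets in auto)
  also have "\<dots> \<le> P.prob ?S + P.prob (space (sample k) - ?W)"
    using sets by (intro measure_Un_le) auto
  also have "P.prob (space (sample k) - ?W) = 1 - P.prob ?W"
    using sets by (rule_tac P.prob_compl)
  finally have 2: "P.prob ?D \<le> P.prob ?S + (1 - P.prob ?W)" .
  have "P.prob ?W \<le> 1" by simp
  moreover have "P.prob ?S = (\<Sum>f\<in>?G. placement_prob k m f)"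
    by (rule measure_Union_placement_box) auto
  moreover have "P.prob ?W = (\<Sum>f\<in>grid_placements k m. placement_prob k m f)"
    by (rule measure_Union_placement_box) auto
  ultimately show ?thesis using 1 2 unfolding realize_prob_def by linarith
qed

end

end

section \<open>Uniform marginals, collisions and convergence of realization probabilities\<close>

locale uniform_planar_sample = planar_sample +
  assumes uniform_X: "p \<in> {0..1} \<Longrightarrow> prob {z \<in> space M. X z \<le> p} = p"
    and uniform_Y: "p \<in> {0..1} \<Longrightarrow> prob {z \<in> space M. Y z \<le> p} = p"
begin

text \<open>The hypotheses are symmetric in the coordinates, so facts about \<open>X\<close>
  transfer to \<open>Y\<close>.\<close>

lemma swap: "uniform_planar_sample M Y X"
  by unfold_locales (simp_all add: uniform_X uniform_Y del: atLeastAtMost_iff)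

lemma AE_X: "AE z in M. 0 < X z \<and> X z \<le> 1"
proof -
  have "AE z in M. \<not> X z \<le> 0" by (subst prob_Collect_eq_0[symmetric]) (auto simp: uniform_X)
  moreover have "AE z in M. X z \<le> 1" by (subst prob_Collect_eq_1[symmetric]) (auto simp: uniform_X)
  ultimately show ?thesis by eventually_elim auto
qed

lemma prob_in_grid:
  assumes "a < m"
  shows "prob {z \<in> space M. in_grid m a (X z)} = 1 / m"
proof -
  have "{z \<in> space M. in_grid m a (X z)} = {z \<in> space M. X z \<le> (real a + 1) / m} - {z \<in> space M. X z \<le> a / m}"
    by (auto simp: in_grid_def)
  moreover have "real a / m \<le> (real a + 1) / m" by (intro divide_right_mono) auto
  then have "prob ({z \<in> space M. X z \<le> (real a + 1) / m} - {z \<in> space M. X z \<le> a / m}) = 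
    prob {z \<in> space M. X z \<le> (real a + 1) / m} - prob {z \<in> space M. X z \<le> a / m}"
    by (intro finite_measure_Diff) auto
  moreover have "prob {z \<in> space M. X z \<le> (real a + 1) / m} = (real a + 1) / m"
      "prob {z \<in> space M. X z \<le> a / m} = a / m"
    using assms by (intro uniform_X; simp)+
  ultimately show ?thesis
    by (simp add: add_divide_distrib)
qed

definition X_collision :: "nat \<Rightarrow> nat \<Rightarrow> nat \<Rightarrow> nat \<Rightarrow> (nat \<Rightarrow> 'a) set" where
  "X_collision k m i j =
     (\<Union>a<m. {\<omega> \<in> space (sample k). \<forall>l\<in>{i, j}. \<omega> l \<in> {z \<in> space M. in_grid m a (X z)}})"

text \<open>Two independent points share a given column with probability 1/m^2, and there are m
  columns.\<close>

lemma
  assumes "i \<in> {1..k}" "j \<in> {1..k}" "i \<noteq> j" "0 < m"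
  shows sets_X_collision: "X_collision k m i j \<in> sets (sample k)"
    and measure_X_collision_le: "measure (sample k) (X_collision k m i j) \<le> 1 / m"
proof -
  interpret P: finite_product_prob_space "\<lambda>_. M" "{1..k}" by (rule finite_product_prob_space_sample)
  have [measurable]: "{z \<in> space M. in_grid m a (X z)} \<in> sets M" for a
    unfolding in_grid_def by measurable
  let ?A = "\<lambda>a. {\<omega> \<in> space (sample k). \<forall>l\<in>{i, j}. \<omega> l \<in> {z \<in> space M. in_grid m a (X z)}}"
  have A: "?A a \<in> sets (sample k)" for a
  proof -
    have [measurable]: "(\<lambda>\<omega>. \<omega> i) \<in> measurable (sample k) M" "(\<lambda>\<omega>. \<omega> j) \<in> measurable (sample k) M"
      using assms by (auto intro!: measurable_component_singleton)
    have "?A a = (\<lambda>\<omega>. \<omega> i) -` {z \<in> space M. in_grid m a (X z)} \<inter> space (sample k) \<inter>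
        ((\<lambda>\<omega>. \<omega> j) -` {z \<in> space M. in_grid m a (X z)} \<inter> space (sample k))" by auto
    also have "\<dots> \<in> sets (sample k)" by measurable
    finally show ?thesis .
  qed
  then show "X_collision k m i j \<in> sets (sample k)"
    unfolding X_collision_def by auto
  have "measure (sample k) (?A a) = 1 / m * (1 / m)" if "a < m" for a
  proof -
    have "emeasure (sample k) (?A a) = (\<Prod>l\<in>{i, j}. emeasure M {z \<in> space M. in_grid m a (X z)})"
      by (rule P.emeasure_PiM_Collect) (use assms in auto)
    also have "\<dots> = ennreal (1 / m * (1 / m))"
      using assms prob_in_grid[OF that] by (simp add: emeasure_eq_measure ennreal_mult[symmetric])
    finally show ?thesis by (simp add: measure_eq_emeasure_eq_ennreal)
  qed
  then have "(\<Sum>a<m. measure (sample k) (?A a)) = 1 / m"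
    using assms by simp
  moreover have "measure (sample k) (X_collision k m i j) \<le> (\<Sum>a<m. measure (sample k) (?A a))"
    unfolding X_collision_def using A by (intro P.P.finite_measure_subadditive_finite) auto
  ultimately show "measure (sample k) (X_collision k m i j) \<le> 1 / m" by simp
qed

lemma AE_sample_X: "AE \<omega> in sample k. \<forall>i\<in>{1..k}. 0 < X (\<omega> i) \<and> X (\<omega> i) \<le> 1"
proof (intro AE_finite_allI)
  show "AE \<omega> in sample k. 0 < X (\<omega> i) \<and> X (\<omega> i) \<le> 1" if "i \<in> {1..k}" for i
    by (rule AE_PiM_component[OF prob_space_axioms that AE_X])
qed simp

lemma X_collisionI:
  assumes "\<omega> \<in> space (sample k)" "i \<in> {1..k}" "j \<in> {1..k}" "in_grid m a (X (\<omega> i))" "in_grid m a (X (\<omega> j))" "a < m"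
  shows "\<omega> \<in> X_collision k m i j"
proof -
  have "\<omega> i \<in> space M" "\<omega> j \<in> space M" using assms(1-3) by (auto simp: space_PiM PiE_iff)
  then show ?thesis using assms by (auto simp: X_collision_def)
qed

text \<open>A tie puts both points into one column of every grid, so its probability is at most 1/m
  for every positive m.\<close>

lemma AE_sample_inj_X: "AE \<omega> in sample k. inj_on (\<lambda>i. X (\<omega> i)) {1..k}"
proof -
  interpret P: prob_space "sample k" by (rule prob_space_sample)
  have "AE \<omega> in sample k. X (\<omega> i) \<noteq> X (\<omega> j)" if ij: "i \<in> {1..k}" "j \<in> {1..k}" "i \<noteq> j" for i j
  proof -
    have meas: "{\<omega> \<in> space (sample k). X (\<omega> i) = X (\<omega> j)} \<in> sets (sample k)" using ij by measurable
    have "P.prob {\<omega> \<in> space (sample k). X (\<omega> i) = X (\<omega> j)} \<le> 1 / real (Suc n)" for n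
    proof -
      have "AE \<omega> in sample k. \<omega> \<in> {\<omega> \<in> space (sample k). X (\<omega> i) = X (\<omega> j)} \<longrightarrow> \<omega> \<in> X_collision k (Suc n) i j"
        using AE_sample_X
      proof eventually_elim
        case (elim \<omega>)
        show ?case
        proof
          assume \<omega>: "\<omega> \<in> {\<omega> \<in> space (sample k). X (\<omega> i) = X (\<omega> j)}"
          obtain a where "a < Suc n" "in_grid (Suc n) a (X (\<omega> i))"
            using in_grid_exists[of "Suc n" "X (\<omega> i)"] elim ij by auto
          with \<omega> ij show "\<omega> \<in> X_collision k (Suc n) i j" by (intro X_collisionI) auto
        qed
      qed
      then have "P.prob {\<omega> \<in> space (sample k). X (\<omega> i) = X (\<omega> j)} \<le> P.prob (X_collision k (Suc n) i j)"
        by (rule P.finite_measure_mono_AE) (use ij in \<open>auto intro: sets_X_collision\<close>)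
      also have "\<dots> \<le> 1 / real (Suc n)" using ij by (intro measure_X_collision_le) auto
      finally show ?thesis .
    qed
    then have "P.prob {\<omega> \<in> space (sample k). X (\<omega> i) = X (\<omega> j)} \<le> 0"
      by (intro LIMSEQ_le_const[OF LIMSEQ_Suc[OF lim_1_over_n]]) auto
    then have "P.prob {\<omega> \<in> space (sample k). X (\<omega> i) = X (\<omega> j)} = 0"
      using measure_nonneg by (rule antisym)
    then show ?thesis using meas by (subst (asm) P.prob_Collect_eq_0) auto
  qed
  then have "AE \<omega> in sample k. \<forall>i\<in>{1..k}. \<forall>j\<in>{1..k}. i \<noteq> j \<longrightarrow> X (\<omega> i) \<noteq> X (\<omega> j)"
    by (intro AE_finite_allI) auto
  then show ?thesis by eventually_elim (auto simp: inj_on_def)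
qed

interpretation swap: uniform_planar_sample M Y X by (rule swap)

lemma AE_sample_inj_Y: "AE \<omega> in sample k. inj_on (\<lambda>i. Y (\<omega> i)) {1..k}"
  by (rule swap.AE_sample_inj_X)

text \<open>Almost surely all coordinates lie in (0, 1], so every point has a cell; a sample outside
  all placement boxes then has two points in one column or row. The union bound runs over at most
  k^2 ordered pairs, each contributing 1/m for columns and 1/m for rows.\<close>

lemma placement_defect_le:
  assumes "0 < m"
  shows "1 - (\<Sum>f\<in>grid_placements k m. placement_prob k m f) \<le> 2 * (real k)\<^sup>2 / m"
proof -
  interpret P: prob_space "sample k" by (rule prob_space_sample)
  let ?W = "\<Union>f\<in>grid_placements k m. placement_box k m f"
  let ?I = "{(i, j) \<in> {1..k} \<times> {1..k}. i \<noteq> j}"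
  let ?C = "\<lambda>(i, j). X_collision k m i j \<union> swap.X_collision k m i j"
  have W: "?W \<in> P.events"
    using finite_grid_placements by (auto intro!: sets.finite_UN)
  have C: "?C c \<in> P.events" if "c \<in> ?I" for c
    using that assms by (auto intro!: sets.Un sets_X_collision swap.sets_X_collision)
  have "AE \<omega> in sample k. \<omega> \<in> space (sample k) - ?W \<longrightarrow> \<omega> \<in> (\<Union>c\<in>?I. ?C c)"
    using AE_sample_X swap.AE_sample_X
  proof eventually_elim
    case (elim \<omega>)
    show ?case
    proof (intro impI, rule ccontr)
      assume \<omega>: "\<omega> \<in> space (sample k) - ?W" and no: "\<omega> \<notin> (\<Union>c\<in>?I. ?C c)"
      have "\<forall>i\<in>{1..k}. \<exists>c. c \<in> {..<m} \<times> {..<m} \<and> in_grid m (fst c) (X (\<omega> i)) \<and> in_grid m (snd c) (Y (\<omega> i))"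
      proof
        fix i assume i: "i \<in> {1..k}"
        obtain a where "a < m" "in_grid m a (X (\<omega> i))"
          using in_grid_exists[OF assms, of "X (\<omega> i)"] elim(1) i by blast
        moreover obtain b where "b < m" "in_grid m b (Y (\<omega> i))"
          using in_grid_exists[OF assms, of "Y (\<omega> i)"] elim(2) i by blast
        ultimately show "\<exists>c. c \<in> {..<m} \<times> {..<m} \<and> in_grid m (fst c) (X (\<omega> i)) \<and> in_grid m (snd c) (Y (\<omega> i))"
          by (intro exI[of _ "(a, b)"]) auto
      qed
      then obtain g where g: "\<And>i. i \<in> {1..k} \<Longrightarrow>
          g i \<in> {..<m} \<times> {..<m} \<and> in_grid m (fst (g i)) (X (\<omega> i)) \<and> in_grid m (snd (g i)) (Y (\<omega> i))"
        by (subst (asm) bchoice_iff) blast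
      have gm: "fst (g i) < m" "snd (g i) < m" if "i \<in> {1..k}" for i
        using g[OF that] by auto
      let ?f = "restrict g {1..k}"
      have distinct: "fst (g i) \<noteq> fst (g j) \<and> snd (g i) \<noteq> snd (g j)" if ij: "i \<in> {1..k}" "j \<in> {1..k}" "i \<noteq> j" for i j
      proof -
        have "(i, j) \<in> ?I" using ij by auto
        then have *: "\<omega> \<notin> X_collision k m i j" "\<omega> \<notin> swap.X_collision k m i j"
          using no by auto
        have "fst (g i) \<noteq> fst (g j)"
          using X_collisionI[of \<omega> k i j m "fst (g i)"] g[OF ij(1)] g[OF ij(2)] gm[OF ij(1)] *(1) ij \<omega> by auto
        moreover have "snd (g i) \<noteq> snd (g j)"
          using swap.X_collisionI[of \<omega> k i j m "snd (g i)"] g[OF ij(1)] g[OF ij(2)] gm[OF ij(1)] *(2) ij \<omega> by auto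
        ultimately show ?thesis ..
      qed
      have "inj_on (\<lambda>i. fst (?f i)) {1..k}" "inj_on (\<lambda>i. snd (?f i)) {1..k}"
        by (intro inj_onI; use distinct in force)+
      moreover have "?f \<in> {1..k} \<rightarrow>\<^sub>E {..<m} \<times> {..<m}" using g by (auto simp del: mem_Times_iff)
      ultimately have "?f \<in> grid_placements k m" by (simp add: grid_placements_def)
      moreover have "\<omega> \<in> placement_box k m ?f"
        using \<omega> g by (auto simp: placement_box_def grid_cell_def space_PiM PiE_iff)
      ultimately show False using \<omega> by blast
    qed
  qed
  then have "P.prob (space (sample k) - ?W) \<le> P.prob (\<Union>c\<in>?I. ?C c)"
    by (rule P.finite_measure_mono_AE) (use C in \<open>intro sets.finite_UN, auto intro: finite_subset[of _ "{1..k} \<times> {1..k}"]\<close>)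
  also have "\<dots> \<le> (\<Sum>c\<in>?I. P.prob (?C c))"
    using C by (intro P.finite_measure_subadditive_finite) (auto intro: finite_subset[of _ "{1..k} \<times> {1..k}"])
  also have "\<dots> \<le> (\<Sum>c\<in>?I. 2 / m)"
  proof (rule sum_mono)
    fix c assume "c \<in> ?I"
    then obtain i j where c: "c = (i, j)" "i \<in> {1..k}" "j \<in> {1..k}" "i \<noteq> j" by auto
    have "P.prob (?C c) \<le> P.prob (X_collision k m i j) + P.prob (swap.X_collision k m i j)"
      using c assms by (auto intro!: measure_Un_le sets_X_collision swap.sets_X_collision)
    also have "\<dots> \<le> 1 / m + 1 / m"
      using c assms by (intro add_mono measure_X_collision_le swap.measure_X_collision_le)
    finally show "P.prob (?C c) \<le> 2 / m" by simp
  qed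
  also have "\<dots> \<le> (\<Sum>c\<in>{1..k} \<times> {1..k}. 2 / m)"
    by (rule sum_mono2) auto
  also have "\<dots> = 2 * (real k)\<^sup>2 / m" by (simp add: power2_eq_square)
  finally show ?thesis
    using P.prob_compl[OF W] measure_Union_placement_box[of "grid_placements k m" k m] by simp
qed

end

text \<open>Whether points lying in pairwise different rows and columns of a grid realize a pattern depends
  only on the cells they occupy, so up to the probability of a collision the pattern probability is a
  polynomial in the finitely many cell probabilities.\<close>

lemma realize_prob_tendsto:
  fixes Mn :: "nat \<Rightarrow> 'b measure" and M :: "'a measure"
  assumes Mn: "\<And>n. planar_sample (Mn n) (Xn n) (Yn n)" and M: "uniform_planar_sample M X Y"
    and lim: "\<And>p q. p \<in> \<rat> \<Longrightarrow> q \<in> \<rat> \<Longrightarrow> p \<in> {0..1} \<Longrightarrow> q \<in> {0..1} \<Longrightarrow>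
      (\<lambda>n. planar_sample.quadrant_prob (Mn n) (Xn n) (Yn n) p q) \<longlonglongrightarrow> planar_sample.quadrant_prob M X Y p q"
  shows "(\<lambda>n. planar_sample.realize_prob (Mn n) (Xn n) (Yn n) k t) \<longlonglongrightarrow> planar_sample.realize_prob M X Y k t"
proof -
  interpret M: uniform_planar_sample M X Y by (rule M)
  interpret Mn: planar_sample "Mn n" "Xn n" "Yn n" for n by (rule Mn)
  have placement: "(\<lambda>n. Mn.placement_prob n k m f) \<longlonglongrightarrow> M.placement_prob k m f"
    if "f \<in> grid_placements k m" "0 < m" for m f
    unfolding Mn.placement_prob_def M.placement_prob_def
  proof (rule tendsto_prod)
    fix i assume "i \<in> {1..k}"
    then have "f i \<in> {..<m} \<times> {..<m}" using that(1) by (auto simp: grid_placements_def PiE_iff)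
    then obtain a b where ab: "f i = (a, b)" "a < m" "b < m" by (cases "f i") auto
    have "real c / m \<in> \<rat>" "(real c + 1) / m \<in> \<rat>" "real c / m \<in> {0..1}" "(real c + 1) / m \<in> {0..1}" if "c < m" for c
      using that by auto
    with ab that(2) show "(\<lambda>n. measure (Mn n) (Mn.grid_cell n m (f i))) \<longlonglongrightarrow> measure M (M.grid_cell m (f i))"
      unfolding ab(1) Mn.prob_grid_cell[OF that(2)] M.prob_grid_cell[OF that(2)]
      by (intro tendsto_diff lim) blast+
  qed
  show ?thesis
  proof (rule LIMSEQ_I)
    fix e :: real assume e: "0 < e"
    obtain m :: nat where m: "2 * (real k)\<^sup>2 / (e / 3) < real m" "0 < m"
      by (metis gr0I of_nat_0_less_iff reals_Archimedean2 less_trans max_less_iff_conj)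
    let ?G = "{f \<in> grid_placements k m. realizes k t (\<lambda>i. real (fst (f i))) (\<lambda>i. real (snd (f i)))}"
    define L where "L = (\<Sum>f\<in>?G. M.placement_prob k m f)"
    define U where "U = 1 - (\<Sum>f\<in>grid_placements k m. M.placement_prob k m f)"
    define Ln where "Ln n = (\<Sum>f\<in>?G. Mn.placement_prob n k m f)" for n
    \<comment> \<open>No collision bound is used for the approximating samples: their defect
      converges to \<open>U\<close>, which is below e/3. Together with the vanishing difference of
      the polynomials it is eventually below 2e/3, and the defect of the limit accounts for the last
      third.\<close>
    define Vn where "Vn n = 1 - (\<Sum>f\<in>grid_placements k m. Mn.placement_prob n k m f)" for n
    have "2 * (real k)\<^sup>2 / m < e / 3" using m e by (simp add: field_simps)
    then have U: "U < e / 3"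
      using M.placement_defect_le[OF m(2), of k] unfolding U_def by linarith
    have "Ln \<longlonglongrightarrow> L" unfolding Ln_def L_def using m(2) by (intro tendsto_sum placement) auto
    moreover have "Vn \<longlonglongrightarrow> U" unfolding Vn_def U_def using m(2) by (intro tendsto_intros placement) auto
    ultimately have "(\<lambda>n. \<bar>Ln n - L\<bar> + Vn n) \<longlonglongrightarrow> \<bar>L - L\<bar> + U" by (intro tendsto_intros)
    then have "\<forall>\<^sub>F n in sequentially. \<bar>Ln n - L\<bar> + Vn n < e / 3 + e / 3"
      using U e by (intro order_tendstoD) auto
    then obtain N where N: "\<bar>Ln n - L\<bar> + Vn n < e / 3 + e / 3" if "n \<ge> N" for n
      by (auto simp: eventually_sequentially)
    have "norm (Mn.realize_prob n k t - M.realize_prob k t) < e" if "n \<ge> N" for n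
      using N[OF that] U Mn.realize_prob_approx[of n k t m] M.realize_prob_approx[of k t m]
      unfolding Ln_def L_def Vn_def U_def real_norm_def by linarith
    then show "\<exists>N. \<forall>n\<ge>N. norm (Mn.realize_prob n k t - M.realize_prob k t) < e" by blast
  qed
qed

section \<open>Measurability of the sections of a limit permutation\<close>

lemma AE_lborel_ex_between:
  fixes a b :: real
  assumes "AE y in lborel. P y" "a < b"
  obtains y where "a < y" "y < b" "P y"
proof -
  have "\<exists>y. a < y \<and> y < b \<and> P y"
  proof (rule ccontr)
    assume "\<nexists>y. a < y \<and> y < b \<and> P y"
    then have "AE y in lborel. y \<notin> {a<..<b}" using assms(1) by (auto elim!: eventually_mono)
    then have "{a<..<b} \<in> null_sets lborel" by (subst (asm) AE_iff_null_sets[symmetric]) auto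
    then show False using assms(2) by (auto simp: null_sets_def)
  qed
  then show ?thesis using that by blast
qed

text \<open>The function agrees with a Borel function off a Borel null set. By Fubini almost every
  horizontal section of that set is null, and on such a section completeness of Lebesgue measure
  carries measurability over from the Borel function.\<close>

lemma AE_borel_measurable_section:
  fixes g :: "real \<times> real \<Rightarrow> real"
  assumes "g \<in> borel_measurable lebesgue"
  shows "AE y in lborel. (\<lambda>x. g (x, y)) \<in> borel_measurable lebesgue"
proof -
  obtain g' where g' [measurable]: "g' \<in> borel_measurable lborel" and eq: "AE z in lborel. g z = g' z"
    using completion_ex_borel_measurable_real[OF assms] by blast
  obtain N where N: "{z \<in> space lborel. g z \<noteq> g' z} \<subseteq> N" "N \<in> null_sets lborel"
    using eq by (rule AE_E) (auto simp: null_sets_def)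
  have NP: "N \<in> null_sets (lborel \<Otimes>\<^sub>M lborel)" using N(2) by (simp add: lborel_prod)
  then have "AE z in lborel \<Otimes>\<^sub>M lborel. z \<notin> N" by (rule AE_not_in)
  then have "AE x in lborel. AE y in lborel. (x, y) \<notin> N"
    by (rule lborel_pair.AE_pair)
  moreover have "{z \<in> space (lborel \<Otimes>\<^sub>M lborel). (fst z, snd z) \<notin> N} = space (lborel \<Otimes>\<^sub>M lborel) - N"
    by auto
  moreover have "space (lborel \<Otimes>\<^sub>M lborel) - N \<in> sets (lborel \<Otimes>\<^sub>M lborel)"
    by (rule sets.compl_sets[OF null_setsD2[OF NP]])
  ultimately have "AE y in lborel. AE x in lborel. (x, y) \<notin> N"
    by (subst (asm) lborel_pair.AE_commute) simp_all
  then show ?thesis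
  proof eventually_elim
    case (elim y)
    have "g' \<in> borel_measurable borel" using g' by simp
    then have "(\<lambda>x. g' (x, y)) \<in> borel_measurable lebesgue"
      by (intro measurable_completion) (auto intro: measurable_compose[OF _ \<open>g' \<in> borel_measurable borel\<close>])
    moreover have "AE x in lebesgue. g' (x, y) = g (x, y)"
      using elim N(1) by (intro AE_completion) (force elim!: eventually_mono)
    ultimately show ?case by (rule borel_measurable_AE)
  qed
qed

abbreviation unit_lebesgue :: "real measure" where
  "unit_lebesgue \<equiv> lebesgue_on {0..1}"

lemma unit_cdf_range: "unit_cdf F \<Longrightarrow> y \<in> {0..1} \<Longrightarrow> F y \<in> {0..1}"
  by (auto simp: unit_cdf_def)

text \<open>Below level 1 the section is a pointwise limit of measurable sections at levels
  approaching from the right. No level of the unit interval lies to the right of 1, but there the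
  section is constant.\<close>

lemma limit_perm_section_measurable:
  assumes Z: "limit_perm Z" and y: "y \<in> {0..1}"
  shows "(\<lambda>x. Z x y) \<in> borel_measurable unit_lebesgue"
proof (cases "y = 1")
  case True
  have "(\<lambda>x. Z x y) \<in> borel_measurable unit_lebesgue \<longleftrightarrow> (\<lambda>x. 1 :: real) \<in> borel_measurable unit_lebesgue"
    by (rule measurable_cong) (use Z True in \<open>auto simp: limit_perm_def unit_cdf_def\<close>)
  then show ?thesis by simp
next
  case False
  then have y: "0 \<le> y" "y < 1" using y by auto
  define g :: "real \<times> real \<Rightarrow> real" where "g z = (if z \<in> {0..1} \<times> {0..1} then (\<lambda>(x, y). Z x y) z else 0)" for z
  have "{0..1} \<times> {0..1} \<in> sets (lebesgue :: (real \<times> real) measure)"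
    by (intro sets_completionI_sets) (auto intro!: borel_closed closed_Times)
  then have "g \<in> borel_measurable lebesgue"
    unfolding g_def using Z by (subst borel_measurable_if) (auto simp: limit_perm_def)
  then have ae: "AE y in lborel. (\<lambda>x. g (x, y)) \<in> borel_measurable lebesgue"
    by (rule AE_borel_measurable_section)
  \<comment> \<open>The factor 1 - y keeps the chosen levels below 1, where \<open>g\<close> still
    coincides with \<open>Z\<close>.\<close>
  have "\<exists>v. y < v \<and> v < y + (1 - y) / real (Suc n) \<and> (\<lambda>x. g (x, v)) \<in> borel_measurable lebesgue" for n
    by (rule AE_lborel_ex_between[OF ae, of y "y + (1 - y) / real (Suc n)"]) (use y in auto)
  then obtain v where v: "y < v n" "v n < y + (1 - y) / real (Suc n)"
      "(\<lambda>x. g (x, v n)) \<in> borel_measurable lebesgue" for n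
    by metis
  have v1: "v n < 1" for n
  proof -
    have "(1 - y) / real (Suc n) \<le> (1 - y) / 1" using y by (intro divide_left_mono) auto
    then show ?thesis using v(2)[of n] by simp
  qed
  have "(\<lambda>n. y + (1 - y) * (1 / real (Suc n))) \<longlonglongrightarrow> y + (1 - y) * 0"
    by (intro tendsto_intros LIMSEQ_Suc[OF lim_1_over_n])
  then have "v \<longlonglongrightarrow> y"
    using v(1,2) by (intro tendsto_sandwich[of "\<lambda>_. y" v sequentially "\<lambda>n. y + (1 - y) * (1 / real (Suc n))"])
      (auto intro!: always_eventually less_imp_le)
  then have vr: "filterlim v (at_right y) sequentially"
    using v(1) by (intro tendsto_imp_filterlim_at_right) auto
  show ?thesis
  proof (rule borel_measurable_LIMSEQ_real)
    fix x assume "x \<in> space unit_lebesgue"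
    then have "unit_cdf (Z x)" using Z by (auto simp: limit_perm_def)
    then have "(Z x \<longlongrightarrow> Z x y) (at_right y)" using y by (auto simp: unit_cdf_def continuous_within)
    then show "(\<lambda>n. Z x (v n)) \<longlonglongrightarrow> Z x y" using vr by (rule filterlim_compose)
  next
    fix n
    have "(\<lambda>x. g (x, v n)) = (\<lambda>x. if x \<in> {0..1} then Z x (v n) else 0)"
      using v1[of n] v(1)[of n] y by (auto simp: g_def)
    then show "(\<lambda>x. Z x (v n)) \<in> borel_measurable unit_lebesgue"
      using v(3)[of n] by (simp only: borel_measurable_if lmeasurable_interval fmeasurableD)
  qed
qed

section \<open>The law of the pair associated with a limit permutation\<close>

lemma
  assumes F: "unit_cdf F"
  shows real_distribution_cdf_measure: "real_distribution (cdf_measure F)"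
    and cdf_cdf_measure: "cdf (cdf_measure F) y = (if y < 0 then 0 else if y \<le> 1 then F y else 1)"
proof -
  let ?F = "\<lambda>y. if y < 0 then 0 else if y \<le> 1 then F y else 1"
  have m: "F y \<le> F z" if "0 \<le> y" "y \<le> z" "z \<le> 1" for y z
    using F that by (auto simp: unit_cdf_def intro: mono_onD)
  have r: "0 \<le> F y" "F y \<le> 1" if "0 \<le> y" "y \<le> 1" for y
    using unit_cdf_range[OF F, of y] that by auto
  have mono: "?F y \<le> ?F z" if "y \<le> z" for y z
    using that m r by auto
  have cont: "continuous (at_right a) ?F" for a
  proof -
    have *: "(?F \<longlongrightarrow> c) (at_right a)" if "(G \<longlongrightarrow> c) (at_right a)" "a < b" "\<And>y. a < y \<Longrightarrow> y < b \<Longrightarrow> ?F y = G y" for b c G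
    proof (rule Lim_transform_eventually[OF that(1)])
      show "\<forall>\<^sub>F y in at_right a. G y = ?F y"
        using that(2) by (intro eventually_at_rightI[of a b]) (simp_all add: that(3)[symmetric])
    qed
    \<comment> \<open>The extension may jump at 0, but 0 itself belongs to the middle range, so only
      limits from the right within one range are needed.\<close>
    consider "a < 0" | "0 \<le> a" "a < 1" | "1 \<le> a" by linarith
    then have "(?F \<longlongrightarrow> ?F a) (at_right a)"
    proof cases
      case 1
      then show ?thesis by (intro *[of "\<lambda>_. 0" _ 0]) auto
    next
      case 2
      then have "(F \<longlongrightarrow> F a) (at_right a)" using F by (auto simp: unit_cdf_def continuous_within)
      then have "(?F \<longlongrightarrow> F a) (at_right a)" using 2 by (intro *[of F _ 1]) auto
      then show ?thesis using 2 by auto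
    next
      case 3
      then have "(?F \<longlongrightarrow> 1) (at_right a)" by (intro *[of "\<lambda>_. 1" _ "a + 1"]) auto
      moreover have "?F a = 1" using 3 F by (auto simp: unit_cdf_def)
      ultimately show ?thesis by simp
    qed
    then show ?thesis by (simp add: continuous_within)
  qed
  have bot: "(?F \<longlongrightarrow> 0) at_bot"
    by (rule tendsto_eventually) (auto simp: eventually_at_bot_linorder intro!: exI[of _ "-1"])
  have top: "(?F \<longlongrightarrow> 1) at_top"
    by (rule tendsto_eventually) (auto simp: eventually_at_top_linorder intro!: exI[of _ 2])
  show "real_distribution (cdf_measure F)"
    unfolding cdf_measure_def by (rule real_distribution_interval_measure[OF mono cont bot top])
  show "cdf (cdf_measure F) y = ?F y"
    unfolding cdf_measure_def by (subst cdf_interval_measure[OF mono cont bot]) auto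
qed

locale limit_permutation =
  fixes Z :: "real \<Rightarrow> real \<Rightarrow> real"
  assumes limit_perm: "limit_perm Z"
begin

lemma unit_cdf_Z: "x \<in> {0..1} \<Longrightarrow> unit_cdf (Z x)"
  using limit_perm by (auto simp: limit_perm_def)

lemma measurable_section [measurable]: "y \<in> {0..1} \<Longrightarrow> (\<lambda>x. Z x y) \<in> borel_measurable unit_lebesgue"
  by (rule limit_perm_section_measurable[OF limit_perm])

lemma prob_space_cdf_measure: "x \<in> {0..1} \<Longrightarrow> prob_space (cdf_measure (Z x))"
  by (intro real_distribution.axioms(1) real_distribution_cdf_measure unit_cdf_Z)

lemma emeasure_cdf_measure_atMost:
  assumes "x \<in> {0..1}"
  shows "emeasure (cdf_measure (Z x)) {..y} = ennreal (if y < 0 then 0 else if y \<le> 1 then Z x y else 1)"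
proof -
  interpret prob_space "cdf_measure (Z x)" using assms by (rule prob_space_cdf_measure)
  show ?thesis
    using cdf_cdf_measure[OF unit_cdf_Z[OF assms], of y] by (simp add: emeasure_eq_measure cdf_def)
qed

lemma emeasure_cdf_measure_UNIV: "x \<in> {0..1} \<Longrightarrow> emeasure (cdf_measure (Z x)) UNIV = 1"
  using prob_space.emeasure_space_1[OF prob_space_cdf_measure, of x] by (simp add: cdf_measure_def)

lemma sets_cdf_measure [simp, measurable_cong]: "sets (cdf_measure F) = sets borel"
  by (simp add: cdf_measure_def)

text \<open>Half-lines form an intersection-stable generator, so measurability of the kernel reduces
  to that of the sections of \<open>Z\<close>.\<close>

lemma cdf_measure_measurable: "(\<lambda>x. cdf_measure (Z x)) \<in> measurable unit_lebesgue (subprob_algebra borel)"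
proof (rule measurable_subprob_algebra_generated[where G = "range atMost" and \<Omega> = UNIV])
  show "sets borel = sigma_sets UNIV (range (atMost :: real \<Rightarrow> _))"
    by (subst borel_eq_atMost) simp
  show "Int_stable (range (atMost :: real \<Rightarrow> _))" by (auto simp: Int_stable_def)
  show "subprob_space (cdf_measure (Z x))" if "x \<in> space unit_lebesgue" for x
    using that by (auto intro!: prob_space_imp_subprob_space prob_space_cdf_measure)
  show "(\<lambda>x. emeasure (cdf_measure (Z x)) A) \<in> borel_measurable unit_lebesgue" if A': "A \<in> range atMost" for A
  proof -
    obtain y where A: "A = {..y}" using A' by (rule rangeE)
    have "(\<lambda>x. if y < 0 then 0 else if y \<le> 1 then Z x y else 1) \<in> borel_measurable unit_lebesgue"
      by (cases "y < 0"; cases "y \<le> 1") auto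
    then have "(\<lambda>x. ennreal (if y < 0 then 0 else if y \<le> 1 then Z x y else 1)) \<in> borel_measurable unit_lebesgue"
      by (rule measurable_compose) simp
    then show ?thesis
      by (subst measurable_cong[OF emeasure_cdf_measure_atMost[of _ y, folded A]]) auto
  qed
  have "emeasure (cdf_measure (Z x)) UNIV = 1" if "x \<in> space unit_lebesgue" for x
    using that by (intro emeasure_cdf_measure_UNIV) simp
  then show "(\<lambda>x. emeasure (cdf_measure (Z x)) UNIV) \<in> borel_measurable unit_lebesgue"
    by (subst measurable_cong) auto
qed auto

lemma emeasure_fibre:
  assumes "A \<in> sets borel" "B \<in> sets borel"
  shows "emeasure (distr (cdf_measure (Z x)) borel (Pair x)) (A \<times> B) =
    indicator A x * emeasure (cdf_measure (Z x)) B"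
proof -
  have "A \<times> B \<in> sets (borel :: (real \<times> real) measure)"
    using assms by (simp add: borel_prod[symmetric])
  moreover have "Pair x \<in> measurable (cdf_measure (Z x)) (borel :: (real \<times> real) measure)"
    by (simp add: borel_prod[symmetric])
  moreover have "Pair x -` (A \<times> B) \<inter> space (cdf_measure (Z x)) = (if x \<in> A then B else {})"
    by (auto simp: cdf_measure_def)
  ultimately show ?thesis by (simp add: emeasure_distr)
qed

lemma fibre_measurable:
  "(\<lambda>x. distr (cdf_measure (Z x)) borel (Pair x)) \<in> measurable unit_lebesgue (subprob_algebra borel)"
proof (rule measurable_subprob_algebra_generated[where G = "{a \<times> b |a b. a \<in> sets borel \<and> b \<in> sets borel}" and \<Omega> = UNIV])
  show "sets (borel :: (real \<times> real) measure) = sigma_sets UNIV {a \<times> b |a b. a \<in> sets borel \<and> b \<in> sets borel}"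
    by (simp add: borel_prod[symmetric] sets_pair_measure)
  show "Int_stable {a \<times> b |a b. a \<in> sets (borel :: real measure) \<and> b \<in> sets (borel :: real measure)}"
    by (rule Int_stable_pair_measure_generator)
  show "subprob_space (distr (cdf_measure (Z x)) borel (Pair x))" if "x \<in> space unit_lebesgue" for x
    using that by (auto intro!: prob_space_imp_subprob_space prob_space.prob_space_distr prob_space_cdf_measure simp: borel_prod[symmetric])
  have *: "(\<lambda>x. indicator A x * emeasure (cdf_measure (Z x)) B) \<in> borel_measurable unit_lebesgue"
    if [measurable]: "A \<in> sets borel" "B \<in> sets borel" for A B
  proof -
    have [measurable]: "(\<lambda>x. emeasure (cdf_measure (Z x)) B) \<in> borel_measurable unit_lebesgue"
      by (rule measurable_compose[OF cdf_measure_measurable]) (auto intro: measurable_emeasure_subprob_algebra)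
    have "indicator A \<in> borel_measurable (lebesgue :: real measure)"
      by (intro measurable_completion) simp
    then have "(indicator A :: real \<Rightarrow> ennreal) \<in> borel_measurable unit_lebesgue"
      by (rule measurable_restrict_space1)
    then show ?thesis by simp
  qed
  show "(\<lambda>x. emeasure (distr (cdf_measure (Z x)) borel (Pair x)) C) \<in> borel_measurable unit_lebesgue"
    if "C \<in> {a \<times> b |a b. a \<in> sets borel \<and> b \<in> sets borel}" for C
    using that * by (auto simp: emeasure_fibre)
  show "(\<lambda>x. emeasure (distr (cdf_measure (Z x)) borel (Pair x)) UNIV) \<in> borel_measurable unit_lebesgue"
    using *[of UNIV UNIV] emeasure_fibre[of UNIV UNIV] by simp
qed auto

lemma sets_pair_law [simp, measurable_cong]: "sets (pair_law Z) = sets borel"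
  unfolding pair_law_def by (rule sets_bind) auto

lemma space_pair_law [simp]: "space (pair_law Z) = UNIV"
  using sets_eq_imp_space_eq[OF sets_pair_law] by simp

lemma emeasure_pair_law_Times:
  assumes "A \<in> sets borel" "B \<in> sets borel"
  shows "emeasure (pair_law Z) (A \<times> B) =
    (\<integral>\<^sup>+x. indicator A x * emeasure (cdf_measure (Z x)) B \<partial>unit_lebesgue)"
proof -
  have "A \<times> B \<in> sets (borel :: (real \<times> real) measure)"
    using assms by (simp add: borel_prod[symmetric])
  then show ?thesis
    unfolding pair_law_def
    by (subst emeasure_bind[OF _ fibre_measurable]) (auto simp: emeasure_fibre[OF assms])
qed

lemma prob_space_pair_law: "prob_space (pair_law Z)"
proof
  have "emeasure (pair_law Z) (UNIV \<times> UNIV) = (\<integral>\<^sup>+x. 1 \<partial>unit_lebesgue)"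
    by (subst emeasure_pair_law_Times) (auto intro!: nn_integral_cong simp: emeasure_cdf_measure_UNIV simp del: nn_integral_const)
  also have "\<dots> = 1" by (simp add: emeasure_restrict_space)
  finally show "emeasure (pair_law Z) (space (pair_law Z)) = 1" by simp
qed

text \<open>These integrals are what \<open>ex_limit_perm\<close> prescribes, so this identifies the
  distribution function of the constructed pair with the limiting copula.\<close>

lemma measure_pair_law_quadrant:
  assumes q: "q \<in> {0..1}"
  shows "measure (pair_law Z) {z. fst z \<le> p \<and> snd z \<le> q} = (LINT x|unit_lebesgue. indicator {..p} x * Z x q)"
proof -
  have "emeasure (pair_law Z) ({..p} \<times> {..q}) = (\<integral>\<^sup>+x. ennreal (indicator {..p} x * Z x q) \<partial>unit_lebesgue)"
    using q by (subst emeasure_pair_law_Times)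
      (auto intro!: nn_integral_cong simp: emeasure_cdf_measure_atMost indicator_def)
  moreover have "{z. fst z \<le> p \<and> snd z \<le> q} = {..p} \<times> {..q}" by auto
  ultimately have "measure (pair_law Z) {z. fst z \<le> p \<and> snd z \<le> q} =
      enn2real (\<integral>\<^sup>+x. ennreal (indicator {..p} x * Z x q) \<partial>unit_lebesgue)"
    by (simp add: measure_def)
  also have "\<dots> = (LINT x|unit_lebesgue. indicator {..p} x * Z x q)"
  proof (rule integral_eq_nn_integral[symmetric])
    have "indicat_real {..p} \<in> borel_measurable unit_lebesgue"
      by (intro measurable_restrict_space1 measurable_completion) simp
    then show "(\<lambda>x. indicat_real {..p} x * Z x q) \<in> borel_measurable unit_lebesgue"
      using q by measurable
    show "AE x in unit_lebesgue. 0 \<le> indicat_real {..p} x * Z x q"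
      by (rule AE_I2) (use unit_cdf_range[OF unit_cdf_Z] q in auto)
  qed
  finally show ?thesis .
qed

text \<open>The first marginal is uniform because every conditional law has mass 1; uniformity of
  the second is the integral condition on a limit permutation.\<close>

lemma uniform_planar_sample: "uniform_planar_sample (pair_law Z) fst snd"
proof -
  interpret prob_space "pair_law Z" by (rule prob_space_pair_law)
  show ?thesis
  proof unfold_locales
    fix p :: real assume p: "p \<in> {0..1}"
    have "emeasure (pair_law Z) ({..p} \<times> UNIV) = (\<integral>\<^sup>+x. indicator {..p} x \<partial>unit_lebesgue)"
      by (subst emeasure_pair_law_Times) (auto intro!: nn_integral_cong simp: emeasure_cdf_measure_UNIV)
    also have "\<dots> = emeasure unit_lebesgue {0..p}"
    proof -
      have "{0..p} \<in> sets unit_lebesgue" using p by (auto simp: sets_restrict_space_iff)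
      moreover have "(\<integral>\<^sup>+x. indicator {..p} x \<partial>unit_lebesgue) = (\<integral>\<^sup>+x. indicator {0..p} x \<partial>unit_lebesgue)"
        by (rule nn_integral_cong) (auto simp: indicator_def)
      ultimately show ?thesis by simp
    qed
    also have "\<dots> = ennreal p" using p by (simp add: emeasure_restrict_space)
    finally have "measure (pair_law Z) ({..p} \<times> UNIV) = p" using p by (simp add: measure_def)
    moreover have "{z \<in> space (pair_law Z). fst z \<le> p} = {..p} \<times> UNIV" by auto
    ultimately show "prob {z \<in> space (pair_law Z). fst z \<le> p} = p" by simp
    have "emeasure (pair_law Z) (UNIV \<times> {..p}) = (\<integral>\<^sup>+x. ennreal (Z x p) \<partial>unit_lebesgue)"
      using p by (subst emeasure_pair_law_Times)
        (auto intro!: nn_integral_cong simp: emeasure_cdf_measure_atMost)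
    then have "measure (pair_law Z) (UNIV \<times> {..p}) = enn2real (\<integral>\<^sup>+x. ennreal (Z x p) \<partial>unit_lebesgue)"
      by (simp add: measure_def)
    also have "\<dots> = (LINT x|unit_lebesgue. Z x p)"
      using p measurable_section unit_cdf_range[OF unit_cdf_Z]
      by (intro integral_eq_nn_integral[symmetric] AE_I2) auto
    also have "\<dots> = p" using limit_perm p by (auto simp: limit_perm_def)
    finally have "measure (pair_law Z) (UNIV \<times> {..p}) = p" .
    moreover have "{z \<in> space (pair_law Z). snd z \<le> p} = UNIV \<times> {..p}" by auto
    ultimately show "prob {z \<in> space (pair_law Z). snd z \<le> p} = p" by simp
  qed (auto simp: borel_prod[symmetric] measurable_cong_sets[OF sets_pair_law refl])
qed

end

section \<open>The density of a pattern in a limit permutation\<close>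

text \<open>Makes \<open>realizes_comp_unique\<close> available for every sample, so the
  disjointness in \<open>limit_density_eq\<close> holds everywhere and not just almost
  surely.\<close>

lemma realizes_comp_inj:
  assumes "\<rho> permutes {1..k}" "realizes k t (x \<circ> \<rho>) y"
  shows "inj_on x {1..k}"
proof -
  have "inj_on (x \<circ> \<rho>) {1..k}"
  proof (rule inj_onI)
    fix i j assume ij: "i \<in> {1..k}" "j \<in> {1..k}" "(x \<circ> \<rho>) i = (x \<circ> \<rho>) j"
    have less: "(x \<circ> \<rho>) i < (x \<circ> \<rho>) j" if "i \<in> {1..k}" "j \<in> {1..k}" "i < j" for i j
      using assms(2) that unfolding realizes_def by blast
    show "i = j" by (metis ij less linorder_neqE_nat order_less_irrefl)
  qed
  then show ?thesis using assms(1) by (metis comp_inj_on_iff inj_on_imageI permutes_image)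
qed

lemma perm_of_points_cong:
  assumes "\<And>l m. l \<in> {1..k} \<Longrightarrow> m \<in> {1..k} \<Longrightarrow> fst (\<omega> l) \<le> fst (\<omega> m) \<longleftrightarrow> fst (\<omega>' l) \<le> fst (\<omega>' m)"
    and "\<And>l m. l \<in> {1..k} \<Longrightarrow> m \<in> {1..k} \<Longrightarrow> snd (\<omega> l) \<le> snd (\<omega> m) \<longleftrightarrow> snd (\<omega>' l) \<le> snd (\<omega>' m)"
  shows "perm_of_points k \<omega> = perm_of_points k \<omega>'"
proof -
  have rank: "rank_among k (fst \<circ> \<omega>) m = rank_among k (fst \<circ> \<omega>') m" "rank_among k (snd \<circ> \<omega>) m = rank_among k (snd \<circ> \<omega>') m"
    if "m \<in> {1..k}" for m
    using assms that by (auto simp: rank_among_def simp del: atLeastAtMost_iff intro!: arg_cong[where f = card])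
  have "(\<exists>m\<in>{1..k}. rank_among k (fst \<circ> \<omega>) m = i \<and> rank_among k (snd \<circ> \<omega>) m = j) \<longleftrightarrow>
      (\<exists>m\<in>{1..k}. rank_among k (fst \<circ> \<omega>') m = i \<and> rank_among k (snd \<circ> \<omega>') m = j)" for i j
    by (intro bex_cong refl) (simp only: rank)
  then show ?thesis by (simp add: perm_of_points_def fun_eq_iff)
qed

lemma (in planar_sample) sets_order_type:
  "{\<omega> \<in> space (sample k). \<forall>l\<in>{1..k}. \<forall>m\<in>{1..k}.
      (X (\<omega> l) \<le> X (\<omega> m) \<longleftrightarrow> A l m) \<and> (Y (\<omega> l) \<le> Y (\<omega> m) \<longleftrightarrow> B l m)} \<in> sets (sample k)"
proof -
  have "{\<omega> \<in> space (sample k). W (\<omega> l) \<le> W (\<omega> m) \<longleftrightarrow> Q} \<in> sets (sample k)"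
    if "W \<in> borel_measurable M" "l \<in> {1..k}" "m \<in> {1..k}" for W :: "'a \<Rightarrow> real" and l m Q
  proof -
    have "(\<lambda>\<omega>. W (\<omega> i)) \<in> borel_measurable (sample k)" if "i \<in> {1..k}" for i
      by (rule measurable_compose[OF measurable_component_singleton[OF that] \<open>W \<in> borel_measurable M\<close>])
    then have "{\<omega> \<in> space (sample k). W (\<omega> l) \<le> W (\<omega> m)} \<in> sets (sample k)"
      using that by (intro borel_measurable_le)
    then show ?thesis
      using sets.sets_Collect_neg by (cases Q) (simp_all only: simp_thms)
  qed
  then show ?thesis
    by (intro sets.sets_Collect_finite_All sets.sets_Collect_conj) simp_all
qed

context limit_permutation
begin

sublocale P: uniform_planar_sample "pair_law Z" fst snd
  by (rule uniform_planar_sample)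

lemma samples_eq: "samples k Z = P.sample k"
  by (simp add: samples_def)

text \<open>The definite description in \<open>perm_of_points\<close> hides measurability. Its value
  depends only on the two comparison relations of the sample, of which there are finitely many, ties
  included; each class is cut out by finitely many coordinate inequalities.\<close>

lemma sets_perm_of_points: "{\<omega> \<in> space (P.sample k). perm_of_points k \<omega> = t} \<in> sets (P.sample k)" (is "?E \<in> _")
proof -
  define R where "R \<omega> = ({(l, m) \<in> {1..k} \<times> {1..k}. fst (\<omega> l) \<le> fst (\<omega> m)},
      {(l, m) \<in> {1..k} \<times> {1..k}. snd (\<omega> l) \<le> snd (\<omega> m)})" for \<omega> :: "nat \<Rightarrow> real \<times> real"
  have R_eq: "R \<omega> = (A, B) \<longleftrightarrow> A \<subseteq> {1..k} \<times> {1..k} \<and> B \<subseteq> {1..k} \<times> {1..k} \<and>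
      (\<forall>l\<in>{1..k}. \<forall>m\<in>{1..k}. (fst (\<omega> l) \<le> fst (\<omega> m) \<longleftrightarrow> (l, m) \<in> A) \<and> (snd (\<omega> l) \<le> snd (\<omega> m) \<longleftrightarrow> (l, m) \<in> B))" for \<omega> A B
    unfolding R_def by auto
  have "finite (R ` ?E)"
    by (rule finite_subset[of _ "Pow ({1..k} \<times> {1..k}) \<times> Pow ({1..k} \<times> {1..k})"]) (auto simp: R_def)
  moreover have "{\<omega> \<in> space (P.sample k). R \<omega> = c} \<in> sets (P.sample k)" for c
  proof -
    obtain A B where c: "c = (A, B)" by (cases c)
    show ?thesis
    proof (cases "A \<subseteq> {1..k} \<times> {1..k} \<and> B \<subseteq> {1..k} \<times> {1..k}")
      case True
      then show ?thesis
        using P.sets_order_type[of k "\<lambda>l m. (l, m) \<in> A" "\<lambda>l m. (l, m) \<in> B"] unfolding c R_eq by (simp only: simp_thms)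
    next
      case False
      then have "{\<omega> \<in> space (P.sample k). R \<omega> = c} = {}" unfolding c R_eq by blast
      then show ?thesis by (simp only: sets.empty_sets)
    qed
  qed
  ultimately have "(\<Union>c\<in>R ` ?E. {\<omega> \<in> space (P.sample k). R \<omega> = c}) \<in> sets (P.sample k)"
    by (intro sets.finite_UN) auto
  moreover have cong: "perm_of_points k \<omega> = perm_of_points k \<omega>'" if "R \<omega> = R \<omega>'" for \<omega> \<omega>'
  proof -
    have "\<forall>l\<in>{1..k}. \<forall>m\<in>{1..k}. (fst (\<omega>' l) \<le> fst (\<omega>' m) \<longleftrightarrow> (l, m) \<in> fst (R \<omega>)) \<and>
        (snd (\<omega>' l) \<le> snd (\<omega>' m) \<longleftrightarrow> (l, m) \<in> snd (R \<omega>))"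
      using R_eq[of \<omega>' "fst (R \<omega>)" "snd (R \<omega>)"] that by simp
    then show ?thesis by (intro perm_of_points_cong) (simp_all add: R_def)
  qed
  have "(\<Union>c\<in>R ` ?E. {\<omega> \<in> space (P.sample k). R \<omega> = c}) = ?E"
  proof (intro equalityI subsetI)
    fix \<omega> assume "\<omega> \<in> (\<Union>c\<in>R ` ?E. {\<omega> \<in> space (P.sample k). R \<omega> = c})"
    then obtain \<omega>' where "perm_of_points k \<omega>' = t" "R \<omega> = R \<omega>'" "\<omega> \<in> space (P.sample k)" by blast
    with cong[of \<omega> \<omega>'] show "\<omega> \<in> ?E" by simp
  qed blast
  ultimately show ?thesis by simp
qed

text \<open>Almost surely the sample has the pattern iff some rearrangement of it realizes the
  pattern in draw order. These k! events are disjoint and equally likely, since the product measure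
  is invariant under permuting its factors.\<close>

lemma limit_density_eq:
  assumes t: "t permutes {1..k}"
  shows "limit_density (k, t) Z = fact k * P.realize_prob k t"
proof -
  interpret S: prob_space "P.sample k" by (rule P.prob_space_sample)
  define D where "D \<rho> = {\<omega> \<in> space (P.sample k). realizes k t (fst \<circ> \<omega> \<circ> \<rho>) (snd \<circ> \<omega> \<circ> \<rho>)}" for \<rho>
  let ?E = "{\<omega> \<in> space (P.sample k). perm_of_points k \<omega> = t}"
  let ?\<Pi> = "{\<rho>. \<rho> permutes {1..k}}"
  have fin: "finite ?\<Pi>" by (rule finite_permutations) simp
  have D_id: "{\<omega> \<in> space (P.sample k). realizes k t (\<lambda>i. fst (\<omega> i)) (\<lambda>i. snd (\<omega> i))} \<in> S.events" (is "?D \<in> _")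
    by (rule P.sets_realizes)
  have shuffle: "D \<rho> \<in> S.events \<and> S.prob (D \<rho>) = P.realize_prob k t" if \<rho>: "\<rho> permutes {1..k}" for \<rho>
  proof -
    let ?s = "\<lambda>\<omega>. \<lambda>i\<in>{1..k}. \<omega> (\<rho> i)"
    have \<rho>k: "\<rho> i \<in> {1..k}" if "i \<in> {1..k}" for i using \<rho> that by (simp only: permutes_in_image)
    have s: "?s \<in> measurable (P.sample k) (P.sample k)"
      using \<rho>k by (intro measurable_restrict measurable_component_singleton)
    have "D \<rho> = ?s -` ?D \<inter> space (P.sample k)"
      using measurable_space[OF s] by (auto simp: D_def realizes_def)
    moreover have "S.prob (?s -` ?D \<inter> space (P.sample k)) = measure (distr (P.sample k) (P.sample k) ?s) ?D"
      using s D_id by (simp add: measure_distr)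
    moreover have "distr (P.sample k) (P.sample k) ?s = P.sample k"
      using distr_PiM_reindex[of "{1..k}" "\<lambda>_. pair_law Z" \<rho> "{1..k}"] \<rho>k permutes_inj_on[OF \<rho>] P.prob_space_axioms
      by auto
    ultimately show ?thesis
      using measurable_sets[OF s D_id] by (simp add: P.realize_prob_def)
  qed
  have "disjoint_family_on D ?\<Pi>"
    unfolding disjoint_family_on_def D_def
    using realizes_comp_unique realizes_comp_inj by blast
  then have "S.prob (\<Union>\<rho>\<in>?\<Pi>. D \<rho>) = (\<Sum>\<rho>\<in>?\<Pi>. S.prob (D \<rho>))"
    using fin shuffle by (intro S.finite_measure_finite_Union) auto
  also have "\<dots> = fact k * P.realize_prob k t"
    using shuffle card_permutations[of "{1..k}" k] by simp
  finally have union: "S.prob (\<Union>\<rho>\<in>?\<Pi>. D \<rho>) = fact k * P.realize_prob k t" .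
  have "AE \<omega> in P.sample k. \<omega> \<in> ?E \<longleftrightarrow> \<omega> \<in> (\<Union>\<rho>\<in>?\<Pi>. D \<rho>)"
    using P.AE_sample_inj_X P.AE_sample_inj_Y
  proof eventually_elim
    case (elim \<omega>)
    then have "perm_of_points k \<omega> = t \<longleftrightarrow>
        (\<exists>\<rho>. \<rho> permutes {1..k} \<and> realizes k t (fst \<circ> \<omega> \<circ> \<rho>) (snd \<circ> \<omega> \<circ> \<rho>))"
      using t by (intro perm_of_points_eq_iff) (simp_all add: comp_def)
    then show ?case by (auto simp: D_def)
  qed
  then have "S.prob ?E = S.prob (\<Union>\<rho>\<in>?\<Pi>. D \<rho>)"
    by (rule S.finite_measure_eq_AE) (use fin shuffle sets_perm_of_points in \<open>auto intro!: sets.finite_UN\<close>)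
  then show ?thesis
    using union by (simp add: limit_density_def samples_eq)
qed

end

section \<open>Pattern counts in finite permutations\<close>

lemma binomial_ratio_tendsto: "(\<lambda>N. real N ^ k / real (N choose k)) \<longlonglongrightarrow> fact k"
proof -
  have "(\<lambda>N. (\<Prod>i = 0..<k. 1 - real i * (1 / real N)) / fact k :: real) \<longlonglongrightarrow> (\<Prod>i = 0..<k. 1 - real i * 0) / fact k"
    by (intro tendsto_intros lim_1_over_n) simp
  then have "(\<lambda>N. inverse ((\<Prod>i = 0..<k. 1 - real i * (1 / real N)) / fact k :: real)) \<longlonglongrightarrow> inverse ((\<Prod>i = 0..<k. 1 - real i * 0) / fact k)"
    by (rule tendsto_inverse) simp
  \<comment> \<open>For 0 < N < k the product has a zero factor and the binomial coefficient
    vanishes, so both sides are 0 by the convention on division by zero.\<close>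
  moreover have "\<forall>\<^sub>F N in sequentially. inverse ((\<Prod>i = 0..<k. 1 - real i * (1 / real N)) / fact k :: real) = real N ^ k / real (N choose k)"
    using eventually_gt_at_top[of 0]
  proof eventually_elim
    case (elim N)
    have "(\<Prod>i = 0..<k. 1 - real i * (1 / real N)) = (\<Prod>i = 0..<k. (real N - real i) / real N)"
      using elim by (intro prod.cong) (auto simp: field_simps)
    also have "\<dots> = (\<Prod>i = 0..<k. real N - real i) / real N ^ k"
      by (simp add: prod_dividef)
    finally have *: "(\<Prod>i = 0..<k. 1 - real i * (1 / real N)) = (\<Prod>i = 0..<k. real N - real i) / real N ^ k" .
    show ?case
      unfolding * by (simp add: binomial_gbinomial gbinomial_prod_rev mult.commute)
  qed
  ultimately show ?thesis by (simp add: Lim_transform_eventually)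
qed

lemma pattern_density_tendsto:
  assumes N: "filterlim N at_top sequentially"
    and lim: "(\<lambda>n. real (occurrences (k, t) (N n, p n)) / real (N n) ^ k) \<longlonglongrightarrow> c"
  shows "(\<lambda>n. pattern_density (k, t) (N n, p n)) \<longlonglongrightarrow> fact k * c"
proof -
  have "(\<lambda>n. real (N n) ^ k / real (N n choose k) * (real (occurrences (k, t) (N n, p n)) / real (N n) ^ k)) \<longlonglongrightarrow> fact k * c"
    by (intro tendsto_mult lim filterlim_compose[OF binomial_ratio_tendsto N])
  \<comment> \<open>\<open>Suc k\<close> rather than k also makes \<open>N n\<close> positive when k
    = 0, so that its power cancels.\<close>
  moreover have "\<forall>\<^sub>F n in sequentially. N n \<ge> Suc k"
    using N by (auto simp: filterlim_at_top)
  then have "\<forall>\<^sub>F n in sequentially. real (N n) ^ k / real (N n choose k) * (real (occurrences (k, t) (N n, p n)) / real (N n) ^ k)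
      = pattern_density (k, t) (N n, p n)"
    by eventually_elim (auto simp: pattern_density_def)
  ultimately show ?thesis by (rule Lim_transform_eventually)
qed

lemma planar_sample_uniform_count:
  assumes "N \<ge> 1"
  shows "planar_sample (uniform_count_measure {1..N::nat}) X Y"
proof -
  interpret prob_space "uniform_count_measure {1..N}"
    by (rule prob_space_uniform_count_measure) (use assms in auto)
  show ?thesis
    by unfold_locales (simp_all add: measurable_def space_uniform_count_measure sets_uniform_count_measure)
qed

lemma quadrant_prob_uniform_count:
  assumes "N \<ge> 1"
  shows "planar_sample.quadrant_prob (uniform_count_measure {1..N::nat}) X Y p q =
    real (card {i \<in> {1..N}. X i \<le> p \<and> Y i \<le> q}) / real N"
proof -
  interpret planar_sample "uniform_count_measure {1..N}" X Y
    using assms by (rule planar_sample_uniform_count)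
  show ?thesis
    unfolding quadrant_prob_def space_uniform_count_measure by (subst measure_uniform_count_measure) auto
qed

lemma realize_prob_uniform_count:
  assumes "N \<ge> 1"
  shows "planar_sample.realize_prob (uniform_count_measure {1..N::nat}) X Y k t =
    real (card {f \<in> {1..k} \<rightarrow>\<^sub>E {1..N}. realizes k t (\<lambda>i. X (f i)) (\<lambda>i. Y (f i))}) / real N ^ k"
proof -
  interpret planar_sample "uniform_count_measure {1..N}" X Y
    using assms by (rule planar_sample_uniform_count)
  interpret S: finite_product_prob_space "\<lambda>_. uniform_count_measure {1..N}" "{1..k}"
    by (rule finite_product_prob_space_sample)
  let ?B = "{f \<in> {1..k} \<rightarrow>\<^sub>E {1..N}. realizes k t (\<lambda>i. X (f i)) (\<lambda>i. Y (f i))}"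
  have single: "{f} \<in> sets (sample k) \<and> measure (sample k) {f} = 1 / real N ^ k" if f: "f \<in> ?B" for f
  proof -
    have eq: "{f} = (\<Pi>\<^sub>E i\<in>{1..k}. {f i})"
      using f by (subst PiE_singleton) (auto simp: PiE_def)
    have sub: "{f i} \<subseteq> {1..N}" if "i \<in> {1..k}" for i using f that by auto
    then have sets: "{f i} \<in> sets (uniform_count_measure {1..N})" if "i \<in> {1..k}" for i
      using that by (simp add: sets_uniform_count_measure)
    have "measure (sample k) (\<Pi>\<^sub>E i\<in>{1..k}. {f i}) = (\<Prod>i\<in>{1..k}. prob {f i})"
      by (rule S.prob_times) (rule sets)
    also have "\<dots> = (\<Prod>i\<in>{1..k}. 1 / real N)"
      using sub by (intro prod.cong) (auto simp: measure_uniform_count_measure)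
    finally show ?thesis
      using sets unfolding eq by (auto intro!: sets_PiM_I_finite simp: power_one_over)
  qed
  have fin: "finite ?B" by (rule finite_subset[of _ "{1..k} \<rightarrow>\<^sub>E {1..N}"]) (auto intro!: finite_PiE)
  have "measure (sample k) ?B = measure (sample k) (\<Union>f\<in>?B. {f})" by simp
  also have "\<dots> = (\<Sum>f\<in>?B. measure (sample k) {f})"
    using fin single by (intro S.P.finite_measure_finite_Union) (auto simp: disjoint_family_on_def)
  also have "\<dots> = real (card ?B) / real N ^ k"
    using single by simp
  finally show ?thesis
    by (simp add: realize_prob_def space_PiM space_uniform_count_measure)
qed

section \<open>Typical samples and the approximating sequence\<close>

context planar_sample
begin

lemma indep_vars_sample_coordinates:
  assumes "N \<ge> 1"
  shows "prob_space.indep_vars (sample N) (\<lambda>_. M) (\<lambda>i \<omega>. \<omega> i) {1..N}"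
proof -
  interpret S: prob_space "sample N" by (rule prob_space_sample)
  have "distr (sample N) (sample N) (\<lambda>\<omega>. \<lambda>i\<in>{1..N}. \<omega> i) = distr (sample N) (sample N) (\<lambda>\<omega>. \<omega>)"
    by (rule distr_cong) (auto simp: space_PiM)
  also have "\<dots> = sample N" by (rule distr_id2) simp
  also have "\<dots> = (\<Pi>\<^sub>M i\<in>{1..N}. distr (sample N) M (\<lambda>\<omega>. \<omega> i))"
    by (intro PiM_cong refl distr_PiM_component[symmetric] prob_space_axioms) auto
  finally show ?thesis
    using assms by (subst S.indep_vars_iff_distr_eq_PiM') auto
qed

lemma sample_frequency_deviation:
  assumes A [measurable]: "A \<in> events" and N: "N \<ge> 1" and d: "0 \<le> d"
  shows "measure (sample N) {\<omega> \<in> space (sample N). \<bar>(\<Sum>i\<in>{1..N}. indicat_real A (\<omega> i)) - real N * prob A\<bar> \<ge> real N * d}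
    \<le> 2 * exp (- 2 * real N * d\<^sup>2)"
proof -
  interpret S: finite_product_prob_space "\<lambda>_. M" "{1..N}" by (rule finite_product_prob_space_sample)
  have E: "S.P.expectation (\<lambda>\<omega>. indicat_real A (\<omega> i)) = prob A" if i: "i \<in> {1..N}" for i
  proof -
    have "S.P.expectation (\<lambda>\<omega>. indicat_real A (\<omega> i)) = S.P.expectation (indicat_real {\<omega> \<in> space (sample N). \<omega> i \<in> A})"
      by (intro Bochner_Integration.integral_cong) (auto simp: indicator_def)
    also have "\<dots> = S.P.prob {\<omega> \<in> space (sample N). \<omega> i \<in> A}"
      using i by (subst Bochner_Integration.integral_indicator) (auto simp: Int_def conj_commute intro: arg_cong2[where f = measure])
    also have "\<dots> = prob A"
      using S.emeasure_PiM_Collect_single[OF i A] by (simp add: measure_def)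
    finally show ?thesis .
  qed
  interpret H: Hoeffding_ineq "sample N" "{1..N}" "\<lambda>i \<omega>. indicat_real A (\<omega> i)" "\<lambda>_. 0" "\<lambda>_. 1" "\<Sum>i\<in>{1..N}. S.P.expectation (\<lambda>\<omega>. indicat_real A (\<omega> i))"
  proof unfold_locales
    show "S.P.indep_vars (\<lambda>_. borel) (\<lambda>i \<omega>. indicat_real A (\<omega> i)) {1..N}"
      by (rule S.P.indep_vars_compose2[OF indep_vars_sample_coordinates[OF N]]) measurable
  qed (auto intro!: AE_I2 simp: indicator_def)
  have "(\<Sum>i\<in>{1..N}. S.P.expectation (\<lambda>\<omega>. indicat_real A (\<omega> i))) = real N * prob A"
    using E by simp
  moreover have "- 2 * (real N * d)\<^sup>2 / real N = - 2 * real N * d\<^sup>2"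
    using N by (simp add: power2_eq_square)
  ultimately show ?thesis
    using H.Hoeffding_ineq_abs_ge[of "real N * d"] N d by simp
qed

end

context uniform_planar_sample
begin

text \<open>With N = (n + 1)^3 points and tolerance d = 1/(n + 1), the Hoeffding exponent is 2 N d^2
  = 2 (n + 1), so n events fail together with probability at most 2 n exp(- 2 (n + 1)) < 1. Ties
  have probability zero and cannot exhaust the remaining samples.\<close>

lemma exists_typical_sample:
  assumes A: "\<And>j. A j \<in> events" and N: "N = (n + 1) ^ 3"
  obtains \<omega> where "inj_on (\<lambda>i. X (\<omega> i)) {1..N}" "inj_on (\<lambda>i. Y (\<omega> i)) {1..N}"
    "\<And>j. j < n \<Longrightarrow> \<bar>real (card {i \<in> {1..N}. \<omega> i \<in> A j}) / real N - prob (A j)\<bar> < 1 / real (n + 1)"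
proof -
  interpret S: prob_space "sample N" by (rule prob_space_sample)
  define d where "d = 1 / real (n + 1)"
  have N1: "N \<ge> 1" using N by simp
  have Nd: "real N * d\<^sup>2 = real n + 1"
    by (simp add: N d_def power2_eq_square power3_eq_cube)
  define B where "B j = {\<omega> \<in> space (sample N). \<bar>(\<Sum>i\<in>{1..N}. indicat_real (A j) (\<omega> i)) - real N * prob (A j)\<bar> \<ge> real N * d}" for j
  have B_sets: "B j \<in> S.events" for j
    unfolding B_def using A[of j] by measurable
  have "S.prob (\<Union>j<n. B j) \<le> (\<Sum>j<n. S.prob (B j))"
    using B_sets by (intro S.finite_measure_subadditive_finite) auto
  also have "\<dots> \<le> (\<Sum>j<n. 2 * exp (- 2 * real N * d\<^sup>2))"
    unfolding B_def using A N1 by (intro sum_mono sample_frequency_deviation) (auto simp: d_def)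
  also have "- 2 * real N * d\<^sup>2 = - (2 * (real n + 1))" using Nd by simp
  also have "(\<Sum>j<n. 2 * exp (- (2 * (real n + 1)))) = 2 * real n / exp (2 * (real n + 1))"
    by (simp only: exp_minus) (simp add: divide_inverse)
  also have "\<dots> < 1"
  proof -
    have "1 + 2 * (real n + 1) \<le> exp (2 * (real n + 1))" by (rule exp_ge_add_one_self)
    then have "2 * real n < exp (2 * (real n + 1))" by (rule less_le_trans[rotated]) simp
    then show ?thesis by simp
  qed
  finally have less: "S.prob (\<Union>j<n. B j) < 1" .
  have "\<exists>\<omega>\<in>space (sample N). inj_on (\<lambda>i. X (\<omega> i)) {1..N} \<and> inj_on (\<lambda>i. Y (\<omega> i)) {1..N} \<and> \<omega> \<notin> (\<Union>j<n. B j)"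
  proof (rule ccontr)
    assume neg: "\<not> ?thesis"
    have "AE \<omega> in sample N. \<omega> \<in> (\<Union>j<n. B j)"
      using AE_sample_inj_X AE_sample_inj_Y AE_space by eventually_elim (use neg in blast)
    then have "S.prob (\<Union>j<n. B j) = 1"
      using B_sets by (subst S.AE_in_set_eq_1[symmetric]) auto
    with less show False by simp
  qed
  then obtain \<omega> where \<omega>: "\<omega> \<in> space (sample N)" "inj_on (\<lambda>i. X (\<omega> i)) {1..N}" "inj_on (\<lambda>i. Y (\<omega> i)) {1..N}"
      "\<omega> \<notin> (\<Union>j<n. B j)" by blast
  show ?thesis
  proof (rule that[OF \<omega>(2,3)])
    fix j assume "j < n"
    then have "\<omega> \<notin> B j" using \<omega>(4) by blast
    then have "\<bar>(\<Sum>i\<in>{1..N}. indicat_real (A j) (\<omega> i)) - real N * prob (A j)\<bar> < real N * d"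
      using \<omega>(1) by (simp add: B_def)
    moreover have "(\<Sum>i\<in>{1..N}. indicat_real (A j) (\<omega> i)) = real (card {i \<in> {1..N}. \<omega> i \<in> A j})"
      by (simp add: indicator_def sum.If_cases Int_def flip: of_bool_def)
    moreover have "real (card {i \<in> {1..N}. \<omega> i \<in> A j}) - real N * prob (A j) = real N * (real (card {i \<in> {1..N}. \<omega> i \<in> A j}) / real N - prob (A j))"
      using N1 by (simp add: right_diff_distrib)
    ultimately have "real N * \<bar>real (card {i \<in> {1..N}. \<omega> i \<in> A j}) / real N - prob (A j)\<bar> < real N * d"
      by (simp add: abs_mult)
    then show "\<bar>real (card {i \<in> {1..N}. \<omega> i \<in> A j}) / real N - prob (A j)\<bar> < 1 / real (n + 1)"
      using N1 unfolding d_def by (subst (asm) mult_less_cancel_left_pos) simp_all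
  qed
qed

end

lemma (in limit_permutation) exists_convergent_sequence:
  "\<exists>\<sigma>. perm_sequence \<sigma> \<and> filterlim (\<lambda>n. perm_size (\<sigma> n)) at_top sequentially \<and> perms_converge_to \<sigma> Z"
proof -
  define N where "N n = (n + 1) ^ 3" for n :: nat
  \<comment> \<open>Enumerates all rational quadrants. Stage n controls the first n of them, so each
    is controlled from some stage on. A separate sample is fixed for every n; no almost sure
    convergence along one infinite sample is required.\<close>
  define A where "A j = (let r = from_nat j :: rat \<times> rat in
      {z \<in> space (pair_law Z). fst z \<le> of_rat (fst r) \<and> snd z \<le> of_rat (snd r)})" for j
  have A: "A j \<in> P.events" for j unfolding A_def Let_def by measurable
  have "\<forall>n. \<exists>\<omega>. inj_on (\<lambda>i. fst (\<omega> i)) {1..N n} \<and> inj_on (\<lambda>i. snd (\<omega> i)) {1..N n} \<and>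
      (\<forall>j<n. \<bar>real (card {i \<in> {1..N n}. \<omega> i \<in> A j}) / real (N n) - P.prob (A j)\<bar> < 1 / real (n + 1))"
    by (rule allI, rule P.exists_typical_sample[where A = A, OF A N_def]) blast
  from choice[OF this] obtain \<omega> where \<omega>x: "\<And>n. inj_on (\<lambda>i. fst (\<omega> n i)) {1..N n}" and \<omega>y: "\<And>n. inj_on (\<lambda>i. snd (\<omega> n i)) {1..N n}"
    and dev: "\<And>n j. j < n \<Longrightarrow> \<bar>real (card {i \<in> {1..N n}. \<omega> n i \<in> A j}) / real (N n) - P.prob (A j)\<bar> < 1 / real (n + 1)"
    by blast
  have N1: "N n \<ge> 1" for n by (simp add: N_def)
  have Ntop: "filterlim N at_top sequentially"
  proof (rule filterlim_at_top_mono[OF filterlim_ident])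
    have "n \<le> N n" for n unfolding N_def using self_le_power[of "n + 1" 3] by linarith
    then show "\<forall>\<^sub>F n in sequentially. n \<le> N n" by simp
  qed
  let ?M = "\<lambda>n. uniform_count_measure {1..N n}"
  let ?X = "\<lambda>n i. fst (\<omega> n i)" and ?Y = "\<lambda>n i. snd (\<omega> n i)"
  define \<sigma> where "\<sigma> n = (N n, perm_of_points (N n) (\<omega> n))" for n
  have inj: "inj_on (fst \<circ> \<omega> n) {1..N n}" "inj_on (snd \<circ> \<omega> n) {1..N n}" for n
    using \<omega>x[of n] \<omega>y[of n] by (simp_all add: comp_def)
  have quadrant: "(\<lambda>n. planar_sample.quadrant_prob (?M n) (?X n) (?Y n) p q) \<longlonglongrightarrow> P.quadrant_prob p q"
    if pq: "p \<in> \<rat>" "q \<in> \<rat>" for p q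
  proof -
    obtain a b :: rat where ab: "p = of_rat a" "q = of_rat b" using pq by (auto elim!: Rats_cases)
    define j where "j = to_nat (a, b)"
    have Aj: "A j = {z \<in> space (pair_law Z). fst z \<le> p \<and> snd z \<le> q}"
      by (simp add: A_def j_def ab)
    have "(\<lambda>n. real (card {i \<in> {1..N n}. \<omega> n i \<in> A j}) / real (N n)) \<longlonglongrightarrow> P.prob (A j)"
    proof (rule Lim_null[THEN iffD2])
      show "(\<lambda>n. real (card {i \<in> {1..N n}. \<omega> n i \<in> A j}) / real (N n) - P.prob (A j)) \<longlonglongrightarrow> 0"
      proof (rule Lim_null_comparison)
        show "\<forall>\<^sub>F n in sequentially. norm (real (card {i \<in> {1..N n}. \<omega> n i \<in> A j}) / real (N n) - P.prob (A j)) \<le> 1 / real (n + 1)"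
          using eventually_gt_at_top[of j] by eventually_elim (use dev in \<open>auto intro: less_imp_le\<close>)
        show "(\<lambda>n. 1 / real (n + 1)) \<longlonglongrightarrow> 0" using LIMSEQ_Suc[OF lim_1_over_n[where 'a = real]] by (simp add: add.commute)
      qed
    qed
    then show ?thesis
      unfolding quadrant_prob_uniform_count[OF N1] P.quadrant_prob_def Aj by simp
  qed
  have "perms_converge_to \<sigma> Z"
    unfolding perms_converge_to_def
  proof
    fix \<tau> assume "\<tau> \<in> perms"
    then obtain k t where \<tau>: "\<tau> = (k, t)" "t permutes {1..k}" by (auto simp: perms_def)
    have "(\<lambda>n. planar_sample.realize_prob (?M n) (?X n) (?Y n) k t) \<longlonglongrightarrow> P.realize_prob k t"
      by (rule realize_prob_tendsto[OF planar_sample_uniform_count[OF N1] uniform_planar_sample quadrant])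
    then have "(\<lambda>n. real (occurrences (k, t) (N n, perm_of_points (N n) (\<omega> n))) / real (N n) ^ k) \<longlonglongrightarrow> P.realize_prob k t"
      unfolding realize_prob_uniform_count[OF N1] occurrences_perm_of_points[OF inj] .
    then have "(\<lambda>n. pattern_density (k, t) (N n, perm_of_points (N n) (\<omega> n))) \<longlonglongrightarrow> fact k * P.realize_prob k t"
      by (rule pattern_density_tendsto[OF Ntop])
    then show "(\<lambda>n. pattern_density \<tau> (\<sigma> n)) \<longlonglongrightarrow> limit_density \<tau> Z"
      by (simp add: \<tau>(1) \<sigma>_def limit_density_eq[OF \<tau>(2)])
  qed
  moreover have "perm_sequence \<sigma>"
    using N1 perm_of_points_permutes[OF inj] by (auto simp: perm_sequence_def perms_def \<sigma>_def)
  moreover have "filterlim (\<lambda>n. perm_size (\<sigma> n)) at_top sequentially"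
    using Ntop by (simp add: \<sigma>_def)
  ultimately show ?thesis by blast
qed

section \<open>Densities of slowly increasing functions\<close>

text \<open>A Dynkin argument from half-lines. It is applied to complementary distribution functions
  that add up to the uniform one, and yields that \<open>M\<close> is dominated by
  \<open>U\<close>.\<close>

lemma emeasure_eq_add_if_atMost:
  fixes M M' U :: "real measure"
  assumes "finite_measure M" "finite_measure M'" "finite_measure U"
    and sets: "sets M = sets borel" "sets M' = sets borel" "sets U = sets borel"
    and UNIV: "emeasure U UNIV = emeasure M UNIV + emeasure M' UNIV"
    and atMost: "\<And>p. emeasure U {..p} = emeasure M {..p} + emeasure M' {..p}"
    and A: "A \<in> sets borel"
  shows "emeasure U A = emeasure M A + emeasure M' A"
proof -
  interpret M: finite_measure M by fact
  interpret M': finite_measure M' by fact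
  interpret U: finite_measure U by fact
  have space: "space M = UNIV" "space M' = UNIV" "space U = UNIV"
    using sets[THEN sets_eq_imp_space_eq] by simp_all
  have borel: "sets (borel :: real measure) = sigma_sets UNIV (range atMost)"
    by (subst borel_eq_atMost) simp
  have "Int_stable (range (atMost :: real \<Rightarrow> _))" by (auto simp: Int_stable_def)
  moreover have "range atMost \<subseteq> Pow (UNIV :: real set)" by simp
  ultimately show ?thesis
    using A unfolding borel
  proof (induction rule: sigma_sets_induct_disjoint)
    case (basic A)
    then show ?case using atMost by auto
  next
    case (compl A)
    then have A: "A \<in> sets borel" by (simp add: borel)
    \<comment> \<open>Complements require subtraction, hence the passage from extended to finite
      real values.\<close>
    have "measure U A = measure M A + measure M' A" "measure U UNIV = measure M UNIV + measure M' UNIV"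
      using compl(2) UNIV by (simp_all add: U.emeasure_eq_measure M.emeasure_eq_measure M'.emeasure_eq_measure flip: ennreal_plus)
    then have "measure U (UNIV - A) = measure M (UNIV - A) + measure M' (UNIV - A)"
      using A M.finite_measure_compl[of A] M'.finite_measure_compl[of A] U.finite_measure_compl[of A] sets space
      by simp
    then show ?case by (simp add: U.emeasure_eq_measure M.emeasure_eq_measure M'.emeasure_eq_measure flip: ennreal_plus)
  next
    case (union A)
    then have "range A \<subseteq> sets borel" by (simp add: borel)
    then have "emeasure V (\<Union>i. A i) = (\<Sum>i. emeasure V (A i))" if "sets V = sets borel" for V
      using union(1) that by (intro suminf_emeasure[symmetric]) auto
    then show ?case using sets union(3) by (simp add: suminf_add)
  qed simp_all
qed

text \<open>The distribution function of the uniform law on the unit interval, extended to the whole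
  line.\<close>

definition unit_clip :: "real \<Rightarrow> real" where
  "unit_clip p = min 1 (max 0 p)"

text \<open>A Borel counterpart of \<open>unit_lebesgue\<close> on the whole line, comparable with
  measures given by distribution functions; \<open>integral_unit_lebesgue_eq\<close> translates
  back.\<close>

definition unit_uniform :: "real measure" where
  "unit_uniform = density lborel (indicator {0..1})"

lemma sets_unit_uniform [simp, measurable_cong]: "sets unit_uniform = sets borel"
  by (simp add: unit_uniform_def)

lemma space_unit_uniform [simp]: "space unit_uniform = UNIV"
  by (simp add: unit_uniform_def)

lemma emeasure_unit_uniform: "A \<in> sets borel \<Longrightarrow> emeasure unit_uniform A = emeasure lborel ({0..1} \<inter> A)"
  by (simp add: unit_uniform_def emeasure_density indicator_inter_arith[symmetric])

lemma emeasure_unit_uniform_atMost: "emeasure unit_uniform {..p} = ennreal (unit_clip p)"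
proof -
  have "{0..1} \<inter> {..p} = (if p < 0 then {} else {0..min 1 p})" by auto
  then show ?thesis by (cases "p < 0") (simp_all add: emeasure_unit_uniform unit_clip_def)
qed

lemma prob_space_unit_uniform: "prob_space unit_uniform"
  by (rule prob_spaceI) (simp add: emeasure_unit_uniform)

lemma continuous_at_right_if_slow:
  fixes G :: "real \<Rightarrow> real"
  assumes "\<And>p q. p \<le> q \<Longrightarrow> 0 \<le> G q - G p \<and> G q - G p \<le> unit_clip q - unit_clip p"
  shows "continuous (at_right a) G"
proof -
  have "dist (G x) (G y) \<le> 1 * dist x y" for x y
    using assms[of x y] assms[of y x] by (cases "x \<le> y") (auto simp: dist_real_def unit_clip_def min_def max_def split: if_splits)
  then have "1-lipschitz_on UNIV G" by (intro lipschitz_onI) auto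
  then have "continuous_on UNIV G" by (rule lipschitz_on_continuous_on)
  then show ?thesis by (simp add: continuous_on_eq_continuous_at continuous_at_imp_continuous_at_within)
qed

lemma finite_borel_measure_of_slow:
  fixes G :: "real \<Rightarrow> real"
  assumes slow: "\<And>p q. p \<le> q \<Longrightarrow> 0 \<le> G q - G p \<and> G q - G p \<le> unit_clip q - unit_clip p"
    and G0: "\<And>p. p \<le> 0 \<Longrightarrow> G p = 0"
  obtains M where "finite_measure M" "sets M = sets borel" "\<And>p. emeasure M {..p} = ennreal (G p)"
    "emeasure M UNIV = ennreal (G 1)"
proof
  let ?M = "interval_measure G"
  have bot: "(G \<longlongrightarrow> 0) at_bot"
    by (rule tendsto_eventually) (auto simp: eventually_at_bot_linorder G0 intro!: exI[of _ 0])
  have mono: "G p \<le> G q" if "p \<le> q" for p q using slow[OF that] by simp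
  show *: "emeasure ?M {..p} = ennreal (G p)" for p
    by (rule emeasure_interval_measure_Iic[OF mono continuous_at_right_if_slow[OF slow] bot])
  have "(\<lambda>i. emeasure ?M {..real i}) \<longlonglongrightarrow> emeasure ?M (\<Union>i. {..real i})"
    by (intro Lim_emeasure_incseq) (auto simp: incseq_def)
  moreover have "(\<Union>i. {..real i}) = UNIV" by (auto intro: real_arch_simple)
  moreover have "\<forall>\<^sub>F i in sequentially. emeasure ?M {..real i} = ennreal (G 1)"
    using eventually_ge_at_top[of 1]
  proof eventually_elim
    case (elim i)
    then have "G (real i) = G 1" using slow[of 1 "real i"] by (simp add: unit_clip_def)
    then show ?case by (simp add: *)
  qed
  then have "(\<lambda>i. emeasure ?M {..real i}) \<longlonglongrightarrow> ennreal (G 1)" by (rule tendsto_eventually)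
  ultimately show UNIV: "emeasure ?M UNIV = ennreal (G 1)" by (metis LIMSEQ_unique)
  show "finite_measure ?M" by (rule finite_measureI) (simp add: UNIV)
qed simp

text \<open>\<open>unit_clip\<close> minus \<open>G\<close> satisfies the same hypotheses as
  \<open>G\<close>. The two resulting measures add up to the uniform one, so null sets of the latter
  are null for the former and Radon-Nikodym applies.\<close>

lemma slow_density:
  fixes G :: "real \<Rightarrow> real"
  assumes slow: "\<And>p q. p \<le> q \<Longrightarrow> 0 \<le> G q - G p \<and> G q - G p \<le> unit_clip q - unit_clip p"
    and G0: "\<And>p. p \<le> 0 \<Longrightarrow> G p = 0"
  obtains f where "f \<in> borel_measurable borel" "\<And>p. (\<integral>\<^sup>+x. f x * indicator {..p} x \<partial>unit_uniform) = ennreal (G p)"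
proof -
  interpret U: prob_space unit_uniform by (rule prob_space_unit_uniform)
  obtain M where M: "finite_measure M" "sets M = sets borel" "\<And>p. emeasure M {..p} = ennreal (G p)"
      "emeasure M UNIV = ennreal (G 1)"
    using finite_borel_measure_of_slow[OF slow G0] by blast
  obtain M' where M': "finite_measure M'" "sets M' = sets borel" "\<And>p. emeasure M' {..p} = ennreal (unit_clip p - G p)"
      "emeasure M' UNIV = ennreal (unit_clip 1 - G 1)"
  proof (rule finite_borel_measure_of_slow)
    show "0 \<le> (unit_clip q - G q) - (unit_clip p - G p) \<and> (unit_clip q - G q) - (unit_clip p - G p) \<le> unit_clip q - unit_clip p"
      if "p \<le> q" for p q
      using slow[OF that] by linarith
    show "unit_clip p - G p = 0" if "p \<le> 0" for p using that G0 by (simp add: unit_clip_def)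
  qed blast
  have range: "0 \<le> G p" "G p \<le> unit_clip p" for p
    using slow[of "min 0 p" p] G0[of "min 0 p"] by (auto simp: unit_clip_def min_def split: if_splits)
  have add: "emeasure unit_uniform A = emeasure M A + emeasure M' A" if "A \<in> sets borel" for A
  proof (rule emeasure_eq_add_if_atMost[OF M(1) M'(1) U.finite_measure_axioms M(2) M'(2) _ _ _ that])
    show "emeasure unit_uniform {..p} = emeasure M {..p} + emeasure M' {..p}" for p
      using range[of p] by (simp add: emeasure_unit_uniform_atMost M(3) M'(3) flip: ennreal_plus)
    show "emeasure unit_uniform UNIV = emeasure M UNIV + emeasure M' UNIV"
      using range[of 1] U.emeasure_space_1 by (simp add: M(4) M'(4) unit_clip_def flip: ennreal_plus)
  qed simp
  have "absolutely_continuous unit_uniform M"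
    unfolding absolutely_continuous_def using add M(2) by (auto simp: null_sets_def)
  then obtain f where f [measurable]: "f \<in> borel_measurable unit_uniform" and Mf: "density unit_uniform f = M"
    using U.Radon_Nikodym[of M] M(2) by auto
  show ?thesis
  proof
    show "f \<in> borel_measurable borel" using f by (simp add: measurable_cong_sets[OF sets_unit_uniform refl])
    show "(\<integral>\<^sup>+x. f x * indicator {..p} x \<partial>unit_uniform) = ennreal (G p)" for p
      using M(3)[of p] f unfolding Mf[symmetric] by (subst (asm) emeasure_density) auto
  qed
qed

lemma AE_unit_uniform_eq_if_atMost:
  assumes [measurable]: "f \<in> borel_measurable borel" "g \<in> borel_measurable borel"
    and f: "\<And>p. (\<integral>\<^sup>+x. f x * indicator {..p} x \<partial>unit_uniform) = ennreal (G p)"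
    and g: "\<And>p. (\<integral>\<^sup>+x. g x * indicator {..p} x \<partial>unit_uniform) = ennreal (G p)"
  shows "AE x in unit_uniform. f x = g x"
proof -
  interpret U: prob_space unit_uniform by (rule prob_space_unit_uniform)
  have "density unit_uniform f = density unit_uniform g"
  proof (rule measure_eqI_generator_eq[where E = "range atMost" and \<Omega> = UNIV and A = "\<lambda>i. {..real i}"])
    show "Int_stable (range (atMost :: real \<Rightarrow> _))" by (auto simp: Int_stable_def)
    show "sets (density unit_uniform f) = sigma_sets UNIV (range atMost)"
      "sets (density unit_uniform g) = sigma_sets UNIV (range atMost)"
      by (simp; subst borel_eq_atMost; simp)+
    show "(\<Union>i. {..real i}) = UNIV" by (auto intro: real_arch_simple)
    show "emeasure (density unit_uniform f) {..real i} \<noteq> \<infinity>" for i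
      by (simp add: emeasure_density f)
    show "emeasure (density unit_uniform f) B = emeasure (density unit_uniform g) B" if "B \<in> range atMost" for B
      using that by (auto simp: emeasure_density f g)
  qed auto
  then show ?thesis by (intro U.density_unique) simp_all
qed


lemma integral_unit_lebesgue_eq:
  fixes h :: "real \<Rightarrow> real"
  assumes [measurable]: "h \<in> borel_measurable borel"
  shows "(LINT x|unit_lebesgue. h x) = (LINT x|unit_uniform. h x)"
proof -
  have "(LINT x|unit_lebesgue. h x) = (LINT x|lebesgue. indicator {0..1} x *\<^sub>R h x)"
    by (rule integral_restrict_space) simp
  also have "\<dots> = (LINT x|lborel. indicator {0..1} x *\<^sub>R h x)"
    by (rule integral_completion) simp
  also have "\<dots> = (LINT x|density lborel (\<lambda>x. ennreal (indicator {0..1} x)). h x)"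
    by (rule integral_density[symmetric]) auto
  finally show ?thesis by (simp add: unit_uniform_def ennreal_indicator)
qed

section \<open>From a copula to a limit permutation\<close>

abbreviation unit_rats :: "real set" where
  "unit_rats \<equiv> \<rat> \<inter> {0..1}"

lemma countable_unit_rats: "countable unit_rats"
  by (rule countable_Int1) (rule countable_rat)

text \<open>A joint distribution function with uniform marginals, taken on the whole plane so that
  quadrants need no case distinction at the boundary; \<open>increasing\<close> says that rectangles
  have nonnegative mass.\<close>

locale copula =
  fixes F :: "real \<Rightarrow> real \<Rightarrow> real"
  assumes increasing: "p \<le> p' \<Longrightarrow> q \<le> q' \<Longrightarrow> F p q' + F p' q \<le> F p q + F p' q'"
    and left [simp]: "p \<le> 0 \<Longrightarrow> F p q = 0"
    and bottom [simp]: "q \<le> 0 \<Longrightarrow> F p q = 0"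
    and right: "1 \<le> p \<Longrightarrow> F p q = unit_clip q"
    and top: "1 \<le> q \<Longrightarrow> F p q = unit_clip p"
begin

text \<open>The mass of a vertical strip below level q lies between 0 and the mass of the full
  strip. The levels \<open>min 0 q\<close> and \<open>max 1 q\<close> bound it from below and above
  for every real q.\<close>

lemma slow_left: "p \<le> p' \<Longrightarrow> 0 \<le> F p' q - F p q \<and> F p' q - F p q \<le> unit_clip p' - unit_clip p"
  using increasing[of p p' "min 0 q" q] increasing[of p p' q "max 1 q"] by (simp add: top)

lemma slow_right: "q \<le> q' \<Longrightarrow> 0 \<le> F p q' - F p q \<and> F p q' - F p q \<le> unit_clip q' - unit_clip q"
  using increasing[of "min 0 p" p q q'] increasing[of p "max 1 p" q q'] by (simp add: right)

lemma nonneg: "0 \<le> F p q"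
  using slow_left[of "min 0 p" p q] by simp

lemma ex_density:
  "\<exists>f. f \<in> borel_measurable borel \<and> (\<forall>p. (\<integral>\<^sup>+x. f x * indicator {..p} x \<partial>unit_uniform) = ennreal (F p q))"
  by (rule slow_density[of "\<lambda>p. F p q", OF slow_left]) auto

text \<open>By the rectangle inequality the increment of \<open>F\<close> from q to q' is itself
  slow in p and so has a nonnegative density h. Then f + h and f' have the same integrals over
  half-lines and agree almost everywhere, without any subtraction of extended values.\<close>

lemma AE_density_mono:
  assumes [measurable]: "f \<in> borel_measurable borel" "f' \<in> borel_measurable borel"
    and f: "\<And>p. (\<integral>\<^sup>+x. f x * indicator {..p} x \<partial>unit_uniform) = ennreal (F p q)"
    and f': "\<And>p. (\<integral>\<^sup>+x. f' x * indicator {..p} x \<partial>unit_uniform) = ennreal (F p q')"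
    and q: "q \<le> q'"
  shows "AE x in unit_uniform. f x \<le> f' x"
proof -
  obtain h where h [measurable]: "h \<in> borel_measurable borel"
    and h_int: "\<And>p. (\<integral>\<^sup>+x. h x * indicator {..p} x \<partial>unit_uniform) = ennreal (F p q' - F p q)"
  proof (rule slow_density[of "\<lambda>p. F p q' - F p q"])
    show "0 \<le> (F b q' - F b q) - (F a q' - F a q) \<and> (F b q' - F b q) - (F a q' - F a q) \<le> unit_clip b - unit_clip a"
      if "a \<le> b" for a b
      using increasing[OF that q] slow_left[OF that, of q] slow_left[OF that, of q'] by linarith
  qed auto
  have "AE x in unit_uniform. f x + h x = f' x"
  proof (rule AE_unit_uniform_eq_if_atMost[OF _ _ _ f'])
    fix p
    have "(\<integral>\<^sup>+x. (f x + h x) * indicator {..p} x \<partial>unit_uniform) =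
        (\<integral>\<^sup>+x. f x * indicator {..p} x \<partial>unit_uniform) + (\<integral>\<^sup>+x. h x * indicator {..p} x \<partial>unit_uniform)"
      by (subst nn_integral_add[symmetric]) (auto simp: distrib_right)
    also have "\<dots> = ennreal (F p q')"
      using slow_right[OF q, of p] nonneg[of p q] by (simp add: f h_int flip: ennreal_plus)
    finally show "(\<integral>\<^sup>+x. (f x + h x) * indicator {..p} x \<partial>unit_uniform) = ennreal (F p q')" .
  qed auto
  then show ?thesis by eventually_elim (metis le_iff_add)
qed

lemma ex_monotone_densities:
  obtains g where "\<And>q. g q \<in> borel_measurable borel" "\<And>q x. q \<in> unit_rats \<Longrightarrow> g q x \<in> {0..1}"
    "\<And>q q' x. q \<in> unit_rats \<Longrightarrow> q' \<in> unit_rats \<Longrightarrow> q \<le> q' \<Longrightarrow> g q x \<le> g q' x"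
    "\<And>q p. q \<in> unit_rats \<Longrightarrow> (LINT x|unit_uniform. indicator {..p} x * g q x) = F p q"
proof -
  interpret U: prob_space unit_uniform by (rule prob_space_unit_uniform)
  obtain f where f [measurable]: "\<And>q. f q \<in> borel_measurable borel"
    and f_int: "\<And>q p. (\<integral>\<^sup>+x. f q x * indicator {..p} x \<partial>unit_uniform) = ennreal (F p q)"
    using ex_density by metis
  \<comment> \<open>Collects countably many almost sure conditions into one. Normalizing the density
    at level 1 bounds all densities below it by 1, hence makes them finite.\<close>
  define E where "E x \<longleftrightarrow> f 1 x = 1 \<and> (\<forall>q\<in>unit_rats. \<forall>q'\<in>unit_rats. q \<le> q' \<longrightarrow> f q x \<le> f q' x)" for x
  have [measurable]: "Measurable.pred borel E"
  proof -
    have "Measurable.pred borel (\<lambda>x. f 1 x = 1)" by measurable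
    moreover have "Measurable.pred borel (\<lambda>x. \<forall>q\<in>unit_rats. \<forall>q'\<in>unit_rats. q \<le> q' \<longrightarrow> f q x \<le> f q' x)"
      unfolding pred_def by (intro sets.sets_Collect_countable_All' countable_unit_rats) measurable
    ultimately show ?thesis unfolding E_def by (rule pred_intros_logic)
  qed
  have "AE x in unit_uniform. f 1 x = 1"
  proof (rule AE_unit_uniform_eq_if_atMost[OF _ _ f_int])
    show "(\<integral>\<^sup>+x. 1 * indicator {..p} x \<partial>unit_uniform) = ennreal (F p 1)" for p
      by (simp add: emeasure_unit_uniform_atMost top)
  qed auto
  moreover have "AE x in unit_uniform. \<forall>q\<in>unit_rats. \<forall>q'\<in>unit_rats. q \<le> q' \<longrightarrow> f q x \<le> f q' x"
    using AE_density_mono[OF f f f_int f_int] by (intro AE_ball_countable' countable_unit_rats) auto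
  ultimately have AE_E: "AE x in unit_uniform. E x" unfolding E_def by eventually_elim blast
  have le_1: "f q x \<le> 1" if "E x" "q \<in> unit_rats" for q x
  proof -
    have "(1 :: real) \<in> unit_rats" "q \<le> 1" using that(2) by simp_all
    then have "f q x \<le> f 1 x" using that unfolding E_def by blast
    then show ?thesis using that(1) by (simp add: E_def)
  qed
  \<comment> \<open>On the exceptional null set the value q, the uniform distribution function,
    keeps range and monotonicity intact at every x.\<close>
  define g where "g q x = (if E x then enn2real (f q x) else q)" for q x
  show ?thesis
  proof
    show g [measurable]: "g q \<in> borel_measurable borel" for q unfolding g_def by measurable
    show range: "g q x \<in> {0..1}" if "q \<in> unit_rats" for q x
      using that le_1[of x q] by (auto simp: g_def intro: enn2real_leI)
    show "g q x \<le> g q' x" if "q \<in> unit_rats" "q' \<in> unit_rats" "q \<le> q'" for q q' x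
    proof (cases "E x")
      case True
      then have "f q x \<le> f q' x" using that by (auto simp: E_def)
      moreover have "f q' x < top" using le_1[OF True that(2)] by (auto simp: le_less_trans)
      ultimately show ?thesis using True by (simp add: g_def enn2real_mono)
    qed (use that in \<open>simp add: g_def\<close>)
    show "(LINT x|unit_uniform. indicator {..p} x * g q x) = F p q" if q: "q \<in> unit_rats" for q p
    proof -
      have "(LINT x|unit_uniform. indicator {..p} x * g q x) =
          enn2real (\<integral>\<^sup>+x. ennreal (indicator {..p} x * g q x) \<partial>unit_uniform)"
        using range[OF q] by (intro integral_eq_nn_integral AE_I2) auto
      also have "(\<integral>\<^sup>+x. ennreal (indicator {..p} x * g q x) \<partial>unit_uniform) = (\<integral>\<^sup>+x. f q x * indicator {..p} x \<partial>unit_uniform)"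
      proof (rule nn_integral_cong_AE, use AE_E in eventually_elim)
        case (elim x)
        have "f q x < top" using le_1[OF elim q] by (auto simp: le_less_trans)
        then show ?case using elim by (auto simp: g_def indicator_def)
      qed
      finally show ?thesis by (simp add: f_int nonneg)
    qed
  qed
qed

text \<open>The densities are only indexed by rationals; taking the infimum over rationals above \<open>y\<close> makes
  every section right-continuous, and by the Lipschitz property of a copula it does not change the integrals.\<close>

lemma ex_limit_perm:
  obtains Z where "limit_perm Z"
    "\<And>p y. y \<in> {0..1} \<Longrightarrow> (LINT x|unit_lebesgue. indicator {..p} x * Z x y) = F p y"
proof -
  interpret U: prob_space unit_uniform by (rule prob_space_unit_uniform)
  obtain g where g [measurable]: "\<And>q. g q \<in> borel_measurable borel" and range: "\<And>q x. q \<in> unit_rats \<Longrightarrow> g q x \<in> {0..1}"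
    and mono: "\<And>q q' x. q \<in> unit_rats \<Longrightarrow> q' \<in> unit_rats \<Longrightarrow> q \<le> q' \<Longrightarrow> g q x \<le> g q' x"
    and int: "\<And>q p. q \<in> unit_rats \<Longrightarrow> (LINT x|unit_uniform. indicator {..p} x * g q x) = F p q"
    by (rule ex_monotone_densities) blast
  \<comment> \<open>Replacing densities at levels not above y by 1 lets the infimum run over the
    fixed countable set \<open>unit_rats\<close>. This gives joint Borel measurability, and the
    value 1 at y = 1, where no admissible level lies above.\<close>
  define T where "T x y q = (if y < q then g q x else 1)" for x y q :: real
  define Z where "Z x y = (INF q\<in>unit_rats. T x y q)" for x y
  have T: "0 \<le> T x y q" "T x y q \<le> 1" if "q \<in> unit_rats" for x y q
    using range[OF that, of x] by (auto simp: T_def)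
  have ne: "unit_rats \<noteq> {}" by (auto intro!: exI[of _ 0])
  have bdd: "bdd_below ((\<lambda>q. T x y q) ` unit_rats)" for x y
    using T by (intro bdd_belowI[of _ 0]) auto
  have Z_le: "Z x y \<le> T x y q" if "q \<in> unit_rats" for x y q
    unfolding Z_def using bdd that by (intro cINF_lower) auto
  have Z_ge: "c \<le> Z x y" if "\<And>q. q \<in> unit_rats \<Longrightarrow> c \<le> T x y q" for c x y
    unfolding Z_def using ne that by (intro cINF_greatest) auto
  have Z0: "0 \<le> Z x y" for x y by (rule Z_ge) (rule T)
  have Z1: "Z x y \<le> 1" for x y using Z_le[of 0 x y] T(2)[of 0 x y] by simp
  have Z_top: "Z x 1 = 1" for x
    using Z1 by (intro antisym) (auto intro!: Z_ge simp: T_def)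
  have Z_less: "Z x y \<le> g q x" if "q \<in> unit_rats" "y < q" for x y q
    using Z_le[OF that(1), of x y] that by (simp add: T_def)
  have g_le: "g q x \<le> Z x y" if q: "q \<in> unit_rats" "q \<le> y" for x y q
    using that range[OF q(1), of x] by (intro Z_ge) (auto simp: T_def intro!: mono)
  have cdf: "unit_cdf (Z x)" for x
    unfolding unit_cdf_def
  proof (intro conjI ballI)
    show "Z x \<in> {0..1} \<rightarrow> {0..1}" using Z0 Z1 by auto
    have Z_mono: "Z x y \<le> Z x y'" if "y \<le> y'" for y y'
    proof (rule Z_ge)
      fix q assume q: "q \<in> unit_rats"
      then show "Z x y \<le> T x y' q"
        using Z_less[OF q, of y x] Z1[of x y] that by (auto simp: T_def)
    qed
    then show "mono_on {0..1} (Z x)" by (auto intro: mono_onI)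
    show "Z x 1 = 1" by (rule Z_top)
    fix y :: real assume y: "y \<in> {0..<1}"
    have "(Z x \<longlongrightarrow> Z x y) (at_right y)"
    proof (rule order_tendstoI)
      fix c assume "c < Z x y"
      then have "c < Z x y'" if "y < y'" for y' using Z_mono[of y y'] that by simp
      then show "\<forall>\<^sub>F y' in at_right y. c < Z x y'" by (rule eventually_mono[OF eventually_at_right_less])
    next
      fix c assume c: "Z x y < c"
      then obtain q where q: "q \<in> unit_rats" "T x y q < c"
        unfolding Z_def using cINF_less_iff[OF ne bdd] by blast
      \<comment> \<open>If the level q does not exceed y, its term is the default 1, so c exceeds 1
        and level 1 serves as r.\<close>
      obtain r where r: "r \<in> unit_rats" "y < r" "g r x < c"
      proof (cases "y < q")
        case True
        then show ?thesis using q that by (simp add: T_def)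
      next
        case False
        then have "1 < c" using q(2) by (simp add: T_def)
        then show ?thesis using that[of 1] range[of 1 x] y by auto
      qed
      then have "Z x y' < c" if "y' < r" for y' using Z_less[OF r(1) that, of x] by simp
      then show "\<forall>\<^sub>F y' in at_right y. Z x y' < c"
        using r(2) by (intro eventually_at_rightI[of y r]) auto
    qed
    then show "continuous (at_right y) (Z x)" by (simp add: continuous_within)
  qed
  have "(\<lambda>z. Z (fst z) (snd z)) \<in> borel_measurable (borel \<Otimes>\<^sub>M borel)"
    unfolding Z_def T_def
    by (rule borel_measurable_cINF[OF countable_unit_rats _ bdd[unfolded T_def]]) measurable
  then have meas: "(\<lambda>(x, y). Z x y) \<in> borel_measurable (borel :: (real \<times> real) measure)"
    by (simp add: borel_prod case_prod_beta')
  then have [measurable]: "(\<lambda>x. Z x y) \<in> borel_measurable borel" for y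
    using measurable_compose[of "\<lambda>x. (x, y)" borel borel "\<lambda>(x, y). Z x y" borel] by simp
  have integrable: "integrable unit_uniform (\<lambda>x. indicator {..p} x * h x)"
    if "h \<in> borel_measurable borel" "\<And>x. h x \<in> {0..1}" for h :: "real \<Rightarrow> real" and p
    using that by (intro U.integrable_const_bound[of _ 1] AE_I2) (auto simp: indicator_def)
  \<comment> \<open>Rational levels on either side of y squeeze \<open>Z\<close>. The endpoints are
    separate since one side has no level in the unit interval: at 1 \<open>Z\<close> is constant,
    and at 0 \<open>F\<close> vanishes.\<close>
  have eq: "(LINT x|unit_uniform. indicator {..p} x * Z x y) = F p y" if y: "y \<in> {0..1}" for p y
  proof (rule antisym)
    have mono_int: "(LINT x|unit_uniform. indicator {..p} x * h x) \<le> (LINT x|unit_uniform. indicator {..p} x * k x)"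
      if "h \<in> borel_measurable borel" "k \<in> borel_measurable borel" "\<And>x. h x \<in> {0..1}" "\<And>x. k x \<in> {0..1}" "\<And>x. h x \<le> k x" for h k :: "real \<Rightarrow> real"
      using that by (intro integral_mono integrable) (auto simp: mult_left_mono)
    show "(LINT x|unit_uniform. indicator {..p} x * Z x y) \<le> F p y"
    proof (cases "y = 1")
      case True
      then show ?thesis using emeasure_unit_uniform_atMost[of p]
        by (simp add: Z_top top measure_def unit_clip_def)
    next
      case False
      then have y1: "y < 1" using y by simp
      show ?thesis
      proof (rule field_le_epsilon)
        fix e :: real assume "0 < e"
        then obtain q where q: "q \<in> \<rat>" "y < q" "q < min 1 (y + e)"
          using Rats_dense_in_real[of y "min 1 (y + e)"] y1 by auto
        then have q': "q \<in> unit_rats" using y by auto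
        have "(LINT x|unit_uniform. indicator {..p} x * Z x y) \<le> F p q"
          unfolding int[OF q', symmetric] using Z0 Z1 range[OF q'] Z_less[OF q' q(2)] by (intro mono_int) auto
        also have "\<dots> \<le> F p y + e"
          using slow_right[of y q p] q y by (simp add: unit_clip_def)
        finally show "(LINT x|unit_uniform. indicator {..p} x * Z x y) \<le> F p y + e" .
      qed
    qed
    show "F p y \<le> (LINT x|unit_uniform. indicator {..p} x * Z x y)"
    proof (cases "y = 0")
      case True
      then show ?thesis using Z0 by (simp add: integral_nonneg_AE)
    next
      case False
      then have y0: "0 < y" using y by simp
      show ?thesis
      proof (rule field_le_epsilon)
        fix e :: real assume "0 < e"
        then obtain q where q: "q \<in> \<rat>" "max 0 (y - e) < q" "q < y"
          using Rats_dense_in_real[of "max 0 (y - e)" y] y0 by auto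
        then have q': "q \<in> unit_rats" using y by auto
        have "F p y \<le> F p q + e"
          using slow_right[of q y p] q y by (simp add: unit_clip_def)
        also have "F p q \<le> (LINT x|unit_uniform. indicator {..p} x * Z x y)"
          unfolding int[OF q', symmetric] using Z0 Z1 range[OF q'] g_le[OF q' less_imp_le[OF q(3)]] by (intro mono_int) auto
        finally show "F p y \<le> (LINT x|unit_uniform. indicator {..p} x * Z x y) + e" by simp
      qed
    qed
  qed
  have leb: "(LINT x|unit_lebesgue. indicator {..p} x * Z x y) = F p y" if "y \<in> {0..1}" for p y
    using eq[OF that, of p] by (subst integral_unit_lebesgue_eq) auto
  show ?thesis
  proof
    show "limit_perm Z"
      unfolding limit_perm_def
    proof (intro conjI ballI cdf)
      show "(\<lambda>(x, y). Z x y) \<in> borel_measurable (lebesgue_on ({0..1} \<times> {0..1}))"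
        using meas by (intro measurable_restrict_space1 measurable_completion) simp
      fix y :: real assume y: "y \<in> {0..1}"
      have "(LINT x|unit_lebesgue. Z x y) = (LINT x|unit_lebesgue. indicator {..1} x * Z x y)"
        by (intro Bochner_Integration.integral_cong) auto
      also have "\<dots> = y" using leb[OF y, of 1] y by (simp add: right unit_clip_def)
      finally show "(LINT x|unit_lebesgue. Z x y) = y" .
    qed
  qed (rule leb)
qed

end

section \<open>Empirical distribution functions of permutations\<close>

lemma (in planar_sample) quadrant_prob_increasing:
  assumes "p \<le> p'" "q \<le> q'"
  shows "quadrant_prob p q' + quadrant_prob p' q \<le> quadrant_prob p q + quadrant_prob p' q'"
proof -
  let ?Q = "\<lambda>p q. {z \<in> space M. X z \<le> p \<and> Y z \<le> q}"
  have "prob (?Q p q' \<union> ?Q p' q) = prob (?Q p q') + prob (?Q p' q) - prob (?Q p q' \<inter> ?Q p' q)"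
    by (rule measure_Un3) (auto simp: fmeasurable_eq_sets)
  then have "prob (?Q p q') + prob (?Q p' q) = prob (?Q p q' \<union> ?Q p' q) + prob (?Q p q' \<inter> ?Q p' q)" by simp
  also have "?Q p q' \<inter> ?Q p' q = ?Q p q" using assms by auto
  also have "prob (?Q p q' \<union> ?Q p' q) \<le> prob (?Q p' q')"
    using assms by (intro finite_measure_mono) auto
  finally show ?thesis by (simp add: quadrant_prob_def)
qed

text \<open>The uniform distribution function on the points i/N: both marginals of the scaled graph
  of any permutation of size N.\<close>

definition grid_cdf :: "nat \<Rightarrow> real \<Rightarrow> real" where
  "grid_cdf N p = real (card {i \<in> {1..N}. real i / real N \<le> p}) / real N"

lemma grid_cdf_eq:
  assumes "N \<ge> 1"
  shows "grid_cdf N p = real_of_int \<lfloor>real N * unit_clip p\<rfloor> / real N"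
proof -
  let ?m = "\<lfloor>real N * unit_clip p\<rfloor>"
  have m: "0 \<le> ?m" "?m \<le> int N"
  proof -
    have "real N * unit_clip p \<le> real N * 1" by (intro mult_left_mono) (auto simp: unit_clip_def)
    then show "?m \<le> int N" by (simp add: floor_le_iff)
  qed (simp add: unit_clip_def)
  have "real i / real N \<le> p \<longleftrightarrow> int i \<le> ?m" if i: "i \<in> {1..N}" for i
  proof -
    have "real i / real N \<le> p \<longleftrightarrow> real i / real N \<le> unit_clip p"
    proof -
      have "0 < real i / real N" "real i / real N \<le> 1" using i assms by simp_all
      then show ?thesis by (auto simp: unit_clip_def)
    qed
    also have "\<dots> \<longleftrightarrow> real i \<le> real N * unit_clip p"
      using assms by (simp add: field_simps)
    finally show ?thesis by (simp add: le_floor_iff)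
  qed
  then have "{i \<in> {1..N}. real i / real N \<le> p} = {1..nat ?m}"
    using m by auto
  then show ?thesis using m by (simp add: grid_cdf_def)
qed

lemma grid_cdf_tendsto:
  assumes N: "filterlim N at_top sequentially" and N1: "\<And>n. N n \<ge> (1 :: nat)"
  shows "(\<lambda>n. grid_cdf (N n) p) \<longlonglongrightarrow> unit_clip p"
proof (rule Lim_null[THEN iffD2], rule Lim_null_comparison)
  show "(\<lambda>n. 1 / real (N n)) \<longlonglongrightarrow> 0"
    by (rule filterlim_compose[OF lim_1_over_n N])
  have "norm (grid_cdf (N n) p - unit_clip p) \<le> 1 / real (N n)" for n
  proof -
    have pos: "0 < real (N n)" using N1[of n] by simp
    have "\<bar>real_of_int \<lfloor>real (N n) * unit_clip p\<rfloor> - real (N n) * unit_clip p\<bar> \<le> 1" by linarith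
    then have "\<bar>real_of_int \<lfloor>real (N n) * unit_clip p\<rfloor> - real (N n) * unit_clip p\<bar> / real (N n) \<le> 1 / real (N n)"
      using pos by (intro divide_right_mono) auto
    moreover have "grid_cdf (N n) p - unit_clip p = (real_of_int \<lfloor>real (N n) * unit_clip p\<rfloor> - real (N n) * unit_clip p) / real (N n)"
      using pos by (simp add: grid_cdf_eq[OF N1] diff_divide_distrib)
    ultimately show ?thesis using pos by simp
  qed
  then show "\<forall>\<^sub>F n in sequentially. norm (grid_cdf (N n) p - unit_clip p) \<le> 1 / real (N n)" by simp
qed

definition empirical_cdf :: "sized_perm \<Rightarrow> real \<Rightarrow> real \<Rightarrow> real" where
  "empirical_cdf \<pi> = planar_sample.quadrant_prob (uniform_count_measure {1..perm_size \<pi>})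
     (\<lambda>i. real i / real (perm_size \<pi>)) (\<lambda>i. real (perm_fun \<pi> i) / real (perm_size \<pi>))"

context
  fixes \<pi> :: sized_perm
  assumes \<pi>: "\<pi> \<in> perms"
begin

lemma perm_size_ge_1: "perm_size \<pi> \<ge> 1"
  using \<pi> by (auto simp: perms_def)

lemma empirical_cdf_eq:
  "empirical_cdf \<pi> p q = real (card {i \<in> {1..perm_size \<pi>}. real i / real (perm_size \<pi>) \<le> p \<and>
     real (perm_fun \<pi> i) / real (perm_size \<pi>) \<le> q}) / real (perm_size \<pi>)"
  unfolding empirical_cdf_def by (rule quadrant_prob_uniform_count[OF perm_size_ge_1])

lemma empirical_cdf_increasing:
  "p \<le> p' \<Longrightarrow> q \<le> q' \<Longrightarrow> empirical_cdf \<pi> p q' + empirical_cdf \<pi> p' q \<le> empirical_cdf \<pi> p q + empirical_cdf \<pi> p' q'"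
  unfolding empirical_cdf_def
  by (rule planar_sample.quadrant_prob_increasing[OF planar_sample_uniform_count[OF perm_size_ge_1]])

lemma perm_fun_in: "i \<in> {1..perm_size \<pi>} \<Longrightarrow> perm_fun \<pi> i \<in> {1..perm_size \<pi>}"
  using \<pi> by (auto simp: perms_def permutes_in_image simp del: atLeastAtMost_iff)

lemma empirical_cdf_left:
  assumes "p \<le> 0"
  shows "empirical_cdf \<pi> p q = 0"
proof -
  have "\<not> real i / real (perm_size \<pi>) \<le> p" if "i \<in> {1..perm_size \<pi>}" for i
  proof -
    have "0 < real i / real (perm_size \<pi>)" using that perm_size_ge_1 by simp
    then show ?thesis using assms by simp
  qed
  then show ?thesis unfolding empirical_cdf_eq by (simp del: atLeastAtMost_iff cong: conj_cong)
qed

lemma empirical_cdf_bottom: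
  assumes "q \<le> 0"
  shows "empirical_cdf \<pi> p q = 0"
proof -
  have "\<not> real (perm_fun \<pi> i) / real (perm_size \<pi>) \<le> q" if "i \<in> {1..perm_size \<pi>}" for i
  proof -
    have "0 < real (perm_fun \<pi> i) / real (perm_size \<pi>)"
      using perm_fun_in[OF that] perm_size_ge_1 by simp
    then show ?thesis using assms by simp
  qed
  then show ?thesis unfolding empirical_cdf_eq by (simp del: atLeastAtMost_iff cong: conj_cong)
qed

lemma empirical_cdf_top:
  assumes "1 \<le> q"
  shows "empirical_cdf \<pi> p q = grid_cdf (perm_size \<pi>) p"
proof -
  have "real (perm_fun \<pi> i) / real (perm_size \<pi>) \<le> q" if "i \<in> {1..perm_size \<pi>}" for i
  proof -
    have "real (perm_fun \<pi> i) / real (perm_size \<pi>) \<le> 1"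
      using perm_fun_in[OF that] perm_size_ge_1 by simp
    then show ?thesis using assms by simp
  qed
  then show ?thesis unfolding empirical_cdf_eq grid_cdf_def by (simp del: atLeastAtMost_iff cong: conj_cong)
qed

text \<open>Bijectivity of the permutation turns a count of positions with small values into a count
  of the values themselves.\<close>

lemma empirical_cdf_right:
  assumes "1 \<le> p"
  shows "empirical_cdf \<pi> p q = grid_cdf (perm_size \<pi>) q"
proof -
  have le: "real i / real (perm_size \<pi>) \<le> p" if "i \<in> {1..perm_size \<pi>}" for i
  proof -
    have "real i / real (perm_size \<pi>) \<le> 1" using that perm_size_ge_1 by simp
    then show ?thesis using assms by simp
  qed
  have perm: "perm_fun \<pi> permutes {1..perm_size \<pi>}" using \<pi> by (auto simp: perms_def)
  have "bij_betw (perm_fun \<pi>) {i \<in> {1..perm_size \<pi>}. real (perm_fun \<pi> i) / real (perm_size \<pi>) \<le> q}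
      {j \<in> {1..perm_size \<pi>}. real j / real (perm_size \<pi>) \<le> q}"
    by (rule bij_betw_Collect[OF permutes_imp_bij[OF perm]]) simp
  then have "card {i \<in> {1..perm_size \<pi>}. real (perm_fun \<pi> i) / real (perm_size \<pi>) \<le> q} =
      card {j \<in> {1..perm_size \<pi>}. real j / real (perm_size \<pi>) \<le> q}" by (rule bij_betw_same_card)
  then show ?thesis
    using le unfolding empirical_cdf_eq grid_cdf_def by (simp del: atLeastAtMost_iff cong: conj_cong)
qed

text \<open>The strip argument for copulas, first in p and then in q, with the discrete marginals.
  The bound depends on the permutation only through its size.\<close>

lemma empirical_cdf_slow:
  assumes "p \<le> p'" "q \<le> q'"
  shows "\<bar>empirical_cdf \<pi> p q - empirical_cdf \<pi> p' q'\<bar> \<le>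
    (grid_cdf (perm_size \<pi>) p' - grid_cdf (perm_size \<pi>) p) + (grid_cdf (perm_size \<pi>) q' - grid_cdf (perm_size \<pi>) q)"
proof -
  have left: "0 \<le> empirical_cdf \<pi> p' q - empirical_cdf \<pi> p q"
      "empirical_cdf \<pi> p' q - empirical_cdf \<pi> p q \<le> grid_cdf (perm_size \<pi>) p' - grid_cdf (perm_size \<pi>) p"
    using empirical_cdf_increasing[OF assms(1), of "min 0 q" q] empirical_cdf_increasing[OF assms(1), of q "max 1 q"]
    by (simp_all add: empirical_cdf_bottom empirical_cdf_top)
  have right: "0 \<le> empirical_cdf \<pi> p' q' - empirical_cdf \<pi> p' q"
      "empirical_cdf \<pi> p' q' - empirical_cdf \<pi> p' q \<le> grid_cdf (perm_size \<pi>) q' - grid_cdf (perm_size \<pi>) q"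
    using empirical_cdf_increasing[OF _ assms(2), of "min 0 p'" p'] empirical_cdf_increasing[OF _ assms(2), of p' "max 1 p'"]
    by (simp_all add: empirical_cdf_left empirical_cdf_right)
  show ?thesis using left right by linarith
qed

lemma empirical_cdf_range: "norm (empirical_cdf \<pi> p q) \<le> 1"
proof -
  have "card {i \<in> {1..perm_size \<pi>}. real i / real (perm_size \<pi>) \<le> p \<and>
     real (perm_fun \<pi> i) / real (perm_size \<pi>) \<le> q} \<le> card {1..perm_size \<pi>}"
    by (rule card_mono) auto
  then show ?thesis using perm_size_ge_1 by (simp add: empirical_cdf_eq)
qed

end

section \<open>Compactness and the limit of a convergent sequence\<close>

text \<open>Asymptotic equicontinuity: the functions may jump, but their increments are bounded by
  those of \<open>m n\<close>, whose limit is 1-Lipschitz.\<close>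

lemma convergent_if_convergent_on_Rats:
  fixes a :: "nat \<Rightarrow> real \<Rightarrow> real \<Rightarrow> real" and m :: "nat \<Rightarrow> real \<Rightarrow> real"
  assumes conv: "\<And>p q. p \<in> \<rat> \<Longrightarrow> q \<in> \<rat> \<Longrightarrow> convergent (\<lambda>n. a n p q)"
    and slow: "\<And>n p p' q q'. p \<le> p' \<Longrightarrow> q \<le> q' \<Longrightarrow> \<bar>a n p q - a n p' q'\<bar> \<le> (m n p' - m n p) + (m n q' - m n q)"
    and m: "\<And>p. (\<lambda>n. m n p) \<longlonglongrightarrow> unit_clip p"
  shows "convergent (\<lambda>n. a n p q)"
proof (rule Cauchy_convergent, rule metric_CauchyI)
  fix e :: real assume e: "0 < e"
  \<comment> \<open>Steps of e/8 in each variable make the limiting increment smaller than e/4. Two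
    such errors and e/2 at the rational point add up to e.\<close>
  obtain p' where p': "p' \<in> \<rat>" "p < p'" "p' < p + e / 8"
    using Rats_dense_in_real[of p "p + e / 8"] e by auto
  obtain q' where q': "q' \<in> \<rat>" "q < q'" "q' < q + e / 8"
    using Rats_dense_in_real[of q "q + e / 8"] e by auto
  have "(\<lambda>n. (m n p' - m n p) + (m n q' - m n q)) \<longlonglongrightarrow> (unit_clip p' - unit_clip p) + (unit_clip q' - unit_clip q)"
    by (intro tendsto_intros m)
  moreover have "(unit_clip p' - unit_clip p) + (unit_clip q' - unit_clip q) < e / 4"
  proof -
    have "unit_clip y - unit_clip x \<le> y - x" if "x < y" for x y
      using that by (auto simp: unit_clip_def min_def max_def)
    from this[OF p'(2)] this[OF q'(2)] p'(3) q'(3) show ?thesis by linarith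
  qed
  ultimately have "\<forall>\<^sub>F n in sequentially. (m n p' - m n p) + (m n q' - m n q) < e / 4"
    by (rule order_tendstoD)
  then obtain N1 where N1: "\<And>n. n \<ge> N1 \<Longrightarrow> (m n p' - m n p) + (m n q' - m n q) < e / 4"
    by (auto simp: eventually_sequentially)
  obtain N2 where N2: "\<And>i j. i \<ge> N2 \<Longrightarrow> j \<ge> N2 \<Longrightarrow> \<bar>a i p' q' - a j p' q'\<bar> < e / 2"
    using metric_CauchyD[OF convergent_Cauchy[OF conv[OF p'(1) q'(1)]], of "e / 2"] e by (auto simp: dist_real_def)
  have near: "\<bar>a n p q - a n p' q'\<bar> < e / 4" if "n \<ge> N1" for n
    using slow[OF less_imp_le[OF p'(2)] less_imp_le[OF q'(2)], of n] N1[OF that] by linarith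
  have "dist (a i p q) (a j p q) < e" if "i \<ge> max N1 N2" "j \<ge> max N1 N2" for i j
    using near[of i] near[of j] N2[of i j] that unfolding dist_real_def by linarith
  then show "\<exists>M. \<forall>i\<ge>M. \<forall>j\<ge>M. dist (a i p q) (a j p q) < e" by blast
qed

lemma exists_limit_perm_of_convergent:
  assumes \<sigma>: "convergent_perm_sequence \<sigma>" and size: "filterlim (\<lambda>n. perm_size (\<sigma> n)) at_top sequentially"
  shows "\<exists>Z. limit_perm Z \<and> perms_converge_to \<sigma> Z"
proof -
  have perm: "\<sigma> n \<in> perms" for n using \<sigma> by (auto simp: convergent_perm_sequence_def perm_sequence_def)
  obtain r :: "nat \<Rightarrow> nat" where r: "strict_mono r"
    and rlim: "\<And>z. z \<in> \<rat> \<times> \<rat> \<Longrightarrow> \<exists>l. (\<lambda>n. case_prod (empirical_cdf (\<sigma> (r n))) z) \<longlonglongrightarrow> l"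
  proof (rule function_convergent_subsequence[of "\<rat> \<times> \<rat>" "\<lambda>n. case_prod (empirical_cdf (\<sigma> n))" 1])
    show "countable (\<rat> \<times> \<rat> :: (real \<times> real) set)" by (intro countable_SIGMA countable_rat)
  qed (auto intro: empirical_cdf_range[OF perm, unfolded real_norm_def])
  define N where "N n = perm_size (\<sigma> (r n))" for n
  have N1: "N n \<ge> 1" for n using perm_size_ge_1[OF perm] by (simp add: N_def)
  have Ntop: "filterlim N at_top sequentially"
    unfolding N_def by (rule filterlim_compose[OF size filterlim_subseq[OF r]])
  note grid = grid_cdf_tendsto[OF Ntop N1]
  have "convergent (\<lambda>n. empirical_cdf (\<sigma> (r n)) p q)" for p q
  proof (rule convergent_if_convergent_on_Rats[OF _ _ grid])
    show "convergent (\<lambda>n. empirical_cdf (\<sigma> (r n)) p q)" if "p \<in> \<rat>" "q \<in> \<rat>" for p q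
      using rlim[of "(p, q)"] that by (auto simp: convergent_def)
  qed (unfold N_def, rule empirical_cdf_slow[OF perm])
  then obtain F where F: "\<And>p q. (\<lambda>n. empirical_cdf (\<sigma> (r n)) p q) \<longlonglongrightarrow> F p q"
    unfolding convergent_def by metis
  have "copula F"
  proof
    show "F p q' + F p' q \<le> F p q + F p' q'" if "p \<le> p'" "q \<le> q'" for p p' q q'
      by (rule LIMSEQ_le[OF tendsto_add[OF F F] tendsto_add[OF F F]])
        (use empirical_cdf_increasing[OF perm that] in blast)
    show "F p q = 0" if "p \<le> 0" for p q
      using F[of p q] that by (simp add: empirical_cdf_left[OF perm] LIMSEQ_const_iff)
    show "F p q = 0" if "q \<le> 0" for p q
      using F[of p q] that by (simp add: empirical_cdf_bottom[OF perm] LIMSEQ_const_iff)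
    show "F p q = unit_clip q" if "1 \<le> p" for p q
      using F[of p q] grid[of q] that by (simp add: empirical_cdf_right[OF perm] N_def LIMSEQ_unique)
    show "F p q = unit_clip p" if "1 \<le> q" for p q
      using F[of p q] grid[of p] that by (simp add: empirical_cdf_top[OF perm] N_def LIMSEQ_unique)
  qed
  then interpret copula F .
  obtain Z where Z: "limit_perm Z"
    "\<And>p y. y \<in> {0..1} \<Longrightarrow> (LINT x|unit_lebesgue. indicator {..p} x * Z x y) = F p y"
    by (rule ex_limit_perm) blast
  interpret limit_permutation Z by unfold_locales (rule Z(1))
  let ?M = "\<lambda>n. uniform_count_measure {1..N n}"
  let ?X = "\<lambda>n i. real i / real (N n)" and ?Y = "\<lambda>n i. real (perm_fun (\<sigma> (r n)) i) / real (N n)"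
  have quadrant: "(\<lambda>n. planar_sample.quadrant_prob (?M n) (?X n) (?Y n) p q) \<longlonglongrightarrow> P.quadrant_prob p q"
    if "q \<in> {0..1}" for p q
    using F[of p q] Z(2)[OF that, of p] measure_pair_law_quadrant[OF that, of p]
    by (simp add: P.quadrant_prob_def empirical_cdf_def N_def)
  have "perms_converge_to \<sigma> Z"
    unfolding perms_converge_to_def
  proof
    fix \<tau> assume \<tau>_in: "\<tau> \<in> perms"
    then obtain k t where \<tau>: "\<tau> = (k, t)" "t permutes {1..k}" by (auto simp: perms_def)
    have "(\<lambda>n. planar_sample.realize_prob (?M n) (?X n) (?Y n) k t) \<longlonglongrightarrow> P.realize_prob k t"
      by (rule realize_prob_tendsto[OF planar_sample_uniform_count[OF N1] uniform_planar_sample quadrant])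
    then have "(\<lambda>n. real (occurrences (k, t) (N n, perm_fun (\<sigma> (r n)))) / real (N n) ^ k) \<longlonglongrightarrow> P.realize_prob k t"
      unfolding realize_prob_uniform_count[OF N1] occurrences_eq_card_realizes[OF N1] .
    then have "(\<lambda>n. pattern_density (k, t) (N n, perm_fun (\<sigma> (r n)))) \<longlonglongrightarrow> fact k * P.realize_prob k t"
      by (rule pattern_density_tendsto[OF Ntop])
    then have sub: "(\<lambda>n. pattern_density \<tau> (\<sigma> (r n))) \<longlonglongrightarrow> limit_density \<tau> Z"
      by (simp add: \<tau>(1) N_def limit_density_eq[OF \<tau>(2)])
    \<comment> \<open>Convergence of the densities enters here: the limit along the whole sequence
      exists by hypothesis, and the subsequence identifies it.\<close>
    obtain l where l: "(\<lambda>n. pattern_density \<tau> (\<sigma> n)) \<longlonglongrightarrow> l"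
      using \<sigma> \<tau>_in by (auto simp: convergent_perm_sequence_def convergent_def)
    have "(\<lambda>n. pattern_density \<tau> (\<sigma> (r n))) \<longlonglongrightarrow> l"
      using LIMSEQ_subseq_LIMSEQ[OF l r] by (simp add: comp_def)
    with sub have "l = limit_density \<tau> Z" by (rule LIMSEQ_unique[rotated])
    with l show "(\<lambda>n. pattern_density \<tau> (\<sigma> n)) \<longlonglongrightarrow> limit_density \<tau> Z" by simp
  qed
  with Z(1) show ?thesis by blast
qed

theorem theorem1p6:
  "(\<forall>\<sigma>. convergent_perm_sequence \<sigma> \<and> filterlim (\<lambda>n. perm_size (\<sigma> n)) at_top sequentially
        \<longrightarrow> (\<exists>Z. limit_perm Z \<and> perms_converge_to \<sigma> Z)) \<and>
   (\<forall>Z. limit_perm Z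
        \<longrightarrow> (\<exists>\<sigma>. perm_sequence \<sigma> \<and> filterlim (\<lambda>n. perm_size (\<sigma> n)) at_top sequentially
                \<and> perms_converge_to \<sigma> Z))"
  using exists_limit_perm_of_convergent limit_permutation.exists_convergent_sequence[OF limit_permutation.intro]
  by blast

end
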